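(* Let $K:(0,+\infty)\to(0,+\infty)$ and consider the radially symmetric kernel $K(|x-y|)$ in $\mathbb{R}^{2m}$. Define $\overline{K}:\mathbb{R}^{2m}\times\mathbb{R}^{2m}\to\mathbb{R}$ by $$\overline{K}(x,y):=\frac{1}{\mu(O(m)^2)}\int_{O(m)^2}K(|Rx-y|)\,dR .$$ If $K(\sqrt{\tau})$ is a strictly convex function of $\tau$, then $L_K$ has a positive kernel in $\mathcal{O}$ when acting on doubly radial functions which are odd with respect to the Simons cone $\mathscr{C}$. More precisely, it holds $$\overline{K}(x,y)>\overline{K}(x,y^\star)\qquad\text{for every }x,y\in\mathcal{O}.$$ In addition, if $K\in C^2((0,+\infty))$, then the strict convexity of $\tau\mapsto K(\sqrt{\tau})$ is not only a sufficient condition for the inequality $\overline{K}(x,y)>\overline{K}(x,y^\star)$ for every $x,y\in\mathcal{O}$ to hold, but also a necessary one.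
   Context: Points of $\mathbb{R}^{2m}$ are written $x=(x',x'')\in\mathbb{R}^m\times\mathbb{R}^m$, and $x^\star:=(x'',x')$. The Simons cone is $\mathscr{C}=\{x\in\mathbb{R}^{2m}:|x'|=|x''|\}$ and $\mathcal{O}:=\{x\in\mathbb{R}^{2m}:|x'|>|x''|\}$ is one of its sides. $O(m)$ is the orthogonal group of $\mathbb{R}^m$, $O(m)^2=O(m)\times O(m)$ acts on $\mathbb{R}^{2m}$ by $(R_1,R_2)(x',x'')=(R_1x',R_2x'')$, $\mu$ is a Haar measure on $O(m)^2$ and $dR$ denotes integration with respect to it. A function $w:\mathbb{R}^{2m}\to\mathbb{R}$ is doubly radial if $w(Rx)=w(x)$ for every $R\in O(m)^2$; a doubly radial $w$ is odd with respect to the Simons cone if $w(x)=-w(x^\star)$. $L_K$ is the operator $L_Kw(x)=\int_{\mathbb{R}^{2m}}\{w(x)-w(y)\}K(|x-y|)\,dy$ (principal value). Acting on a doubly radial function $w$ odd with respect to $\mathscr{C}$, it is rewritten as $$L_Kw(x)=\int_{\mathcal{O}}\{w(x)-w(y)\}\{\overline{K}(x,y)-\overline{K}(x,y^\star)\}\,dy+2w(x)\int_{\mathcal{O}}\overline{K}(x,y^\star)\,dy ,$$ and the kernel in $\mathcal{O}$ referred to is $\overline{K}(x,y)-\overline{K}(x,y^\star)$. Strict convexity of $K(\sqrt{\cdot})$ means: $K(\sqrt{\tau_1})+K(\sqrt{\tau_2})>2K(\sqrt{(\tau_1+\tau_2)/2})$ for all $\tau_1\neq\tau_2$ in $(0,+\infty)$.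 *)

theory Defs
  imports "HOL-Analysis.Analysis"
begin

text \<open>
  The space of dimension \<open>2m\<close> is \<open>(real ^ 'm) \<times> (real ^ 'm)\<close> with \<open>m = CARD('m)\<close>; its product norm is
  the Euclidean one, and the map sending \<open>x = (x', x'')\<close> to \<open>(x'', x')\<close> is \<open>prod.swap\<close>.
\<close>

type_synonym 'm space2 = "(real ^ 'm) \<times> (real ^ 'm)"
type_synonym 'm matrix2 = "(real ^ 'm ^ 'm) \<times> (real ^ 'm ^ 'm)"

definition cone_side :: "('m::finite) space2 set" where
  "cone_side = {x. norm (fst x) > norm (snd x)}"

definition O2 :: "('m::finite) matrix2 set" where
  "O2 = {R. orthogonal_matrix (fst R) \<and> orthogonal_matrix (snd R)}"

definition mult2 :: "('m::finite) matrix2 \<Rightarrow> 'm matrix2 \<Rightarrow> 'm matrix2" where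
  "mult2 R S = (fst R ** fst S, snd R ** snd S)"

definition act2 :: "('m::finite) matrix2 \<Rightarrow> 'm space2 \<Rightarrow> 'm space2" where
  "act2 R x = (fst R *v fst x, snd R *v snd x)"

text \<open>
  The group \<open>O2\<close> is compact and second countable, so a Haar measure on it is a nonzero, finite,
  left-invariant Borel measure; regularity is automatic.
\<close>

definition haar_O2 :: "('m::finite) matrix2 measure \<Rightarrow> bool" where
  "haar_O2 \<mu> \<longleftrightarrow>
     sets \<mu> = sets (restrict_space borel O2) \<and>
     finite_measure \<mu> \<and> emeasure \<mu> O2 \<noteq> 0 \<and>
     (\<forall>R\<in>O2. \<forall>A\<in>sets \<mu>. emeasure \<mu> (mult2 R ` A) = emeasure \<mu> A)"

text \<open>
  The profile \<open>K\<close> is given on the positive half-line only. At \<open>0\<close> it is extended by its lower limit,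
  possibly infinite. For \<open>m \<ge> 2\<close> and \<open>x\<close> in \<open>cone_side\<close> the value at \<open>0\<close> enters the average
  \<open>Kbar\<close> below only on a null set of rotations; for \<open>m = 1\<close> it enters when \<open>y\<close> is in the orbit of \<open>x\<close>.
\<close>

definition ext0 :: "(real \<Rightarrow> real) \<Rightarrow> real \<Rightarrow> ennreal" where
  "ext0 K t = (if t > 0 then ennreal (K t) else Liminf (at_right 0) (\<lambda>s. ennreal (K s)))"

text \<open>
  The average takes extended values: for a kernel that is singular at \<open>0\<close> it is infinite when
  \<open>x\<close> and \<open>y\<close> lie in the same orbit and the singularity is not integrable along the orbit.
\<close>

definition Kbar :: "('m::finite) matrix2 measure \<Rightarrow> (real \<Rightarrow> real) \<Rightarrow> 'm space2 \<Rightarrow> 'm space2 \<Rightarrow> ennreal" where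
  "Kbar \<mu> K x y = (\<integral>\<^sup>+ R. ext0 K (norm (act2 R x - y)) \<partial>\<mu>) / emeasure \<mu> O2"

text \<open>
  The kernel in \<open>cone_side\<close> of the operator \<open>L_K\<close> acting on doubly radial functions \<open>w\<close> that are odd
  with respect to the Simons cone: with \<open>J = odd_kernel \<mu> K\<close>, the value \<open>L_K w(x)\<close> is the integral of
  \<open>(w(x) - w(y)) J(x,y)\<close> over \<open>y\<close> in \<open>cone_side\<close>, plus a multiple of \<open>w(x)\<close>.
\<close>

definition odd_kernel :: "('m::finite) matrix2 measure \<Rightarrow> (real \<Rightarrow> real) \<Rightarrow> 'm space2 \<Rightarrow> 'm space2 \<Rightarrow> ereal" where
  "odd_kernel \<mu> K x y = enn2ereal (Kbar \<mu> K x y) - enn2ereal (Kbar \<mu> K x (prod.swap y))"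

definition strictly_convex_pos :: "(real \<Rightarrow> real) \<Rightarrow> bool" where
  "strictly_convex_pos h \<longleftrightarrow>
     (\<forall>\<tau>1>0. \<forall>\<tau>2>0. \<tau>1 \<noteq> \<tau>2 \<longrightarrow> h \<tau>1 + h \<tau>2 > 2 * h ((\<tau>1 + \<tau>2) / 2))"

definition C2_pos :: "(real \<Rightarrow> real) \<Rightarrow> bool" where
  "C2_pos f \<longleftrightarrow> (\<exists>f' f''.
     (\<forall>t>0. (f has_real_derivative f' t) (at t)) \<and>
     (\<forall>t>0. (f' has_real_derivative f'' t) (at t)) \<and>
     continuous_on {0<..} f'')"

end

(*
  With N = |x|^2 + |y|^2 and H(t) = K(sqrt t), invariance of the Haar measure under left and right
  translations gives Kbar(x,y) = average of H(N - 2(a alpha + b beta)), where alpha = R1 e . e and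
  beta = R2 e . e for a unit vector e, a = |x'||y'| and b = |x''||y''|; replacing y by its swap
  replaces (a,b) by (c,d) = (|x'||y''|, |x''||y'|). By uniqueness of the Haar measure the law of
  (alpha,beta) is invariant under sign changes and under exchange, so the average, as a convex
  function of (a,b), is invariant under the symmetries of the square; (c,d) is in the interior of
  the convex hull of the orbit of (a,b). A measurable midpoint convex H is continuous, so no further
  regularity is needed. Conversely, if a C^2 function H is not strictly convex, then it is
  concave on an interval, and the inequality is reversed for x, y with all squared distances there.
*)

theory Submission
  imports Defs
begin

section \<open>Midpoint convex functions on the positive half-line\<close>

lemma strictly_convex_posD:
  assumes "strictly_convex_pos h" "0 < s" "0 < t"
  shows "2 * h ((s + t) / 2) \<le> h s + h t"
    and "s \<noteq> t \<Longrightarrow> 2 * h ((s + t) / 2) < h s + h t"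
  using assms by (cases "s = t"; force simp: strictly_convex_pos_def)+

text \<open>Lebesgue measurability does not survive composition in general. Here the superlevel set
  of the composition is the image of that of \<open>K\<close> under squaring, and differentiable
  maps of the line send Lebesgue sets to Lebesgue sets.\<close>

lemma superlevel_comp_sqrt_lebesgue:
  fixes K :: "real \<Rightarrow> real"
  assumes "K \<in> borel_measurable (lebesgue_on {0<..})"
  shows "{t. 0 < t \<and> M < K (sqrt t)} \<in> sets lebesgue"
proof -
  have "{w \<in> space (lebesgue_on {0<..}). M < K w} \<in> sets (lebesgue_on {0<..})"
    using assms unfolding borel_measurable_iff_greater by blast
  then have S: "{w. 0 < w \<and> M < K w} \<in> sets lebesgue"
    by (simp add: sets_restrict_space_iff Collect_conj_eq greaterThan_def)
  have "(\<lambda>w::real. w\<^sup>2) ` {w. 0 < w \<and> M < K w} \<in> sets lebesgue"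
    by (rule differentiable_image_in_sets_lebesgue[OF S])
       (auto intro!: derivative_intros simp: power2_eq_square)
  moreover have "(\<lambda>w::real. w\<^sup>2) ` {w. 0 < w \<and> M < K w} = {t. 0 < t \<and> M < K (sqrt t)}"
  proof (intro set_eqI iffI)
    fix t assume "t \<in> {t. 0 < t \<and> M < K (sqrt t)}"
    then show "t \<in> (\<lambda>w. w\<^sup>2) ` {w. 0 < w \<and> M < K w}"
      by (intro image_eqI[of _ _ "sqrt t"]) auto
  qed auto
  ultimately show ?thesis
    by simp
qed

text \<open>If \<open>h t > n\<close>, then \<open>h > n\<close> at one of any two points symmetric about \<open>t\<close>, so the superlevel
  sets near \<open>t\<close> have measure bounded below independently of \<open>n\<close>.\<close>

lemma midpoint_convex_bounded_above:
  fixes h :: "real \<Rightarrow> real"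
  assumes mid: "\<And>s t. 0 < s \<Longrightarrow> 0 < t \<Longrightarrow> 2 * h ((s + t) / 2) \<le> h s + h t"
    and meas: "\<And>M. {t. 0 < t \<and> M < h t} \<in> sets lebesgue"
    and "0 < l"
  shows "\<exists>M. \<forall>t\<in>{l..u}. h t \<le> M"
proof (rule ccontr)
  assume "\<nexists>M. \<forall>t\<in>{l..u}. h t \<le> M"
  then have "\<forall>n::nat. \<exists>t\<in>{l..u}. real n < h t"
    by (meson not_le)
  then obtain t where t: "\<And>n. t n \<in> {l..u}" "\<And>n. real n < h (t n)"
    by metis
  \<comment> \<open>The sets decrease, lie in a bounded interval and have empty intersection, so
    their measures tend to 0.\<close>
  define E where "E n = {t. 0 < t \<and> real n < h t} \<inter> {0..u + l}" for n :: nat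
  have E[measurable]: "E n \<in> sets lebesgue" for n
    unfolding E_def using meas by (intro sets.Int) auto
  have fin: "emeasure lebesgue (E n) \<noteq> \<infinity>" for n
  proof -
    have "emeasure lebesgue (E n) \<le> emeasure lebesgue {0..u + l}"
      by (rule emeasure_mono) (auto simp: E_def)
    also have "\<dots> < \<infinity>"
      by (simp add: emeasure_lborel_Icc_eq)
    finally show ?thesis by simp
  qed
  have "(\<lambda>n. emeasure lebesgue (E n)) \<longlonglongrightarrow> emeasure lebesgue (\<Inter>n. E n)"
    proof (rule Lim_emeasure_decseq)
    show "decseq E"
      by (auto simp: decseq_def E_def)
  qed (use E fin in auto)
  moreover have "(\<Inter>n. E n) = {}"
    using reals_Archimedean2 by (fastforce simp: E_def dest: less_asym)
  ultimately have lim: "(\<lambda>n. emeasure lebesgue (E n)) \<longlonglongrightarrow> 0"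
    by simp
  have "ennreal l \<le> emeasure lebesgue (E n) + emeasure lebesgue (E n)" for n
  proof -
    \<comment> \<open>The reflection of \<open>E n\<close> about \<open>t n\<close>.\<close>
    let ?R = "(\<lambda>x. (-1) *\<^sub>R x + 2 * t n) ` E n"
    have R: "?R \<in> sets lebesgue"
      by (rule differentiable_image_in_sets_lebesgue[OF E]) (auto intro!: derivative_intros)
    \<comment> \<open>Since \<open>l \<le> t n\<close>, points within distance \<open>l\<close> to
      the right of \<open>t n\<close> have a positive mirror image, so the midpoint inequality
      applies to the pair.\<close>
    have "{t n<..<t n + l} \<subseteq> E n \<union> ?R"
    proof
      fix x assume x: "x \<in> {t n<..<t n + l}"
      define s where "s = 2 * t n - x"
      have *: "0 < s" "0 < x" "s \<le> u + l" "x \<le> u + l"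
        using x t(1)[of n] \<open>0 < l\<close> by (auto simp: s_def)
      have "2 * h (t n) \<le> h x + h s"
        using mid[of x s] * by (simp add: s_def)
      then have "x \<in> E n \<or> s \<in> E n"
        using * t(2)[of n] by (auto simp: E_def)
      then show "x \<in> E n \<union> ?R"
        by (auto simp: s_def intro!: image_eqI[of x _ "2 * t n - x"])
    qed
    then have "emeasure lebesgue {t n<..<t n + l} \<le> emeasure lebesgue (E n \<union> ?R)"
      using R E by (intro emeasure_mono) auto
    also have "\<dots> \<le> emeasure lebesgue (E n) + emeasure lebesgue ?R"
      by (rule emeasure_subadditive[OF E R])
    also have "emeasure lebesgue ?R = emeasure lebesgue (E n)"
      by (subst emeasure_lebesgue_affine) simp
    finally show ?thesis
      using \<open>0 < l\<close> by simp
  qed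
  moreover have "(\<lambda>n. emeasure lebesgue (E n) + emeasure lebesgue (E n)) \<longlonglongrightarrow> 0 + 0"
    by (intro tendsto_add lim)
  ultimately have "ennreal l \<le> 0 + 0"
    by (intro LIMSEQ_le_const) auto
  then show False
    using \<open>0 < l\<close> by simp
qed

text \<open>The midpoint inequality between \<open>t + 2 * s\<close> and \<open>t\<close> bounds the
  increment at \<open>s\<close> by half of the increment at \<open>2 * s\<close>. Starting from a
  local upper bound, \<open>n\<close> halvings give an increment of at most
  \<open>C / 2 ^ n\<close>.\<close>

lemma midpoint_convex_continuous:
  fixes h :: "real \<Rightarrow> real"
  assumes mid: "\<And>s t. 0 < s \<Longrightarrow> 0 < t \<Longrightarrow> 2 * h ((s + t) / 2) \<le> h s + h t"
    and bdd: "\<And>l u. 0 < l \<Longrightarrow> \<exists>M. \<forall>t\<in>{l..u}. h t \<le> M"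
  shows "continuous_on {0<..} h"
proof -
  have "isCont h t" if "0 < t" for t
  proof -
    obtain M where M: "\<And>s. s \<in> {t / 2..3 * t / 2} \<Longrightarrow> h s \<le> M"
      using bdd[of "t / 2" "3 * t / 2"] half_gt_zero[OF \<open>0 < t\<close>] by blast
    define C where "C = M - h t"
    have upper: "2 ^ n * (h (t + s) - h t) \<le> C" if "2 ^ n * \<bar>s\<bar> \<le> t / 2" for n s
      using that
    proof (induction n arbitrary: s)
      case 0
      then have "t + s \<in> {t / 2..3 * t / 2}"
        by (auto simp: abs_le_iff)
      then show ?case
        using M[of "t + s"] by (simp add: C_def)
    next
      case (Suc n)
      have le: "\<bar>2 * s\<bar> \<le> t / 2"
      proof -
        have "1 * \<bar>2 * s\<bar> \<le> 2 ^ n * \<bar>2 * s\<bar>"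
          by (intro mult_right_mono) auto
        then show ?thesis using Suc.prems by (simp add: abs_mult)
      qed
      have "2 * h (t + s) \<le> h (t + 2 * s) + h t"
        using mid[of "t + 2 * s" t] le \<open>0 < t\<close>
        by (simp add: add_divide_distrib abs_le_iff field_simps)
      then have "2 * (h (t + s) - h t) \<le> h (t + 2 * s) - h t"
        by simp
      then have "2 ^ n * (2 * (h (t + s) - h t)) \<le> 2 ^ n * (h (t + 2 * s) - h t)"
        by (intro mult_left_mono) auto
      also have "\<dots> \<le> C"
        using Suc.IH[of "2 * s"] Suc.prems by (simp add: abs_mult)
      finally show ?case by (simp only: power_Suc2 mult.assoc)
    qed
    \<comment> \<open>The midpoint inequality at \<open>t\<close> itself turns the upper bound at
      \<open>- s\<close> into a lower bound at \<open>s\<close>.\<close>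
    have both: "2 ^ n * \<bar>h (t + s) - h t\<bar> \<le> C" if "2 ^ n * \<bar>s\<bar> \<le> t / 2" for n s
    proof -
      have "1 * \<bar>s\<bar> \<le> 2 ^ n * \<bar>s\<bar>"
        by (intro mult_right_mono) auto
      then have "\<bar>s\<bar> \<le> t / 2" using that by simp
      then have "2 * h t \<le> h (t + s) + h (t - s)"
        using mid[of "t + s" "t - s"] \<open>0 < t\<close> by (simp add: abs_le_iff)
      then have "2 ^ n * - (h (t + s) - h t) \<le> 2 ^ n * (h (t + - s) - h t)"
        by (intro mult_left_mono) auto
      also have "\<dots> \<le> C"
        using upper[of n "- s"] that by simp
      finally show ?thesis
        using upper[OF that] by (auto simp: abs_if)
    qed
    show ?thesis
    unfolding isCont_def
    proof (rule LIM_I)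
      fix e :: real assume "0 < e"
      obtain n :: nat where n: "C / e < 2 ^ n"
        using real_arch_pow[of 2] by auto
      show "\<exists>d>0. \<forall>x. x \<noteq> t \<and> norm (x - t) < d \<longrightarrow> norm (h x - h t) < e"
      proof (intro exI conjI allI impI)
        show "0 < t / 2 / 2 ^ n" using \<open>0 < t\<close> by simp
        fix x assume "x \<noteq> t \<and> norm (x - t) < t / 2 / 2 ^ n"
        then have "2 ^ n * \<bar>x - t\<bar> \<le> t / 2"
          by (simp add: field_simps)
        then have "2 ^ n * \<bar>h x - h t\<bar> \<le> C"
          using both[of n "x - t"] by simp
        also have "\<dots> < 2 ^ n * e"
          using n \<open>0 < e\<close> by (simp add: field_simps)
        finally show "norm (h x - h t) < e" by simp
      qed
    qed
  qed
  then show ?thesis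
    by (simp add: continuous_on_eq_continuous_at)
qed

lemma strictly_convex_pos_continuous:
  assumes "strictly_convex_pos (\<lambda>t. K (sqrt t))" "K \<in> borel_measurable (lebesgue_on {0<..})"
  shows "continuous_on {0<..} (\<lambda>t. K (sqrt t))"
  by (rule midpoint_convex_continuous midpoint_convex_bounded_above
      strictly_convex_posD(1)[OF assms(1)] superlevel_comp_sqrt_lebesgue[OF assms(2)] | assumption)+

text \<open>The function \<open>r \<mapsto> h (u + r) + h (u - r)\<close> has no maximum in the interior of an interval
  around \<open>0\<close>.\<close>

lemma strictly_convex_pos_spread:
  assumes conv: "strictly_convex_pos h" and cont: "continuous_on {0<..} h"
    and "0 < s'" "s' < s" "s \<le> t" "s + t = s' + t'"
  shows "h s + h t < h s' + h t'"
proof -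
  define u where "u = (s + t) / 2"
  define \<phi> where "\<phi> r = h (u + r) + h (u - r)" for r
  define a where "a = u - s'"
  have a: "0 < a" "a < u"
    using assms(3-6) by (auto simp: a_def u_def)
  have "continuous_on {-a..a} \<phi>"
    unfolding \<phi>_def using a
    by (intro continuous_intros continuous_on_compose2[OF cont]) auto
  then obtain \<rho> where \<rho>: "\<rho> \<in> {-a..a}" "\<And>r. r \<in> {-a..a} \<Longrightarrow> \<phi> r \<le> \<phi> \<rho>"
    using continuous_attains_sup[of "{-a..a}" \<phi>] a by auto
  \<comment> \<open>Used twice: at \<open>\<rho>\<close> it is absurd, which forces the maximum to
    an endpoint; at \<open>u - s\<close> it is the claim.\<close>
  have not_max: "\<phi> r < \<phi> \<rho>" if r: "\<bar>r\<bar> < a" for r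
  proof -
    define e where "e = a - \<bar>r\<bar>"
    have e: "0 < e" "r + e \<in> {-a..a}" "r - e \<in> {-a..a}"
      using r by (auto simp: e_def)
    have pos: "0 < u + (r + e)" "0 < u + (r - e)" "0 < u - (r + e)" "0 < u - (r - e)"
      using e a by auto
    have mid: "(u + (r + e) + (u + (r - e))) / 2 = u + r" "(u - (r + e) + (u - (r - e))) / 2 = u - r"
      by (simp_all add: field_simps)
    have "2 * h (u + r) < h (u + (r + e)) + h (u + (r - e))"
      using strictly_convex_posD(2)[OF conv pos(1,2), unfolded mid] e(1) by simp
    moreover have "2 * h (u - r) < h (u - (r + e)) + h (u - (r - e))"
      using strictly_convex_posD(2)[OF conv pos(3,4), unfolded mid] e(1) by simp
    ultimately have "2 * \<phi> r < \<phi> (r + e) + \<phi> (r - e)"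
      by (simp add: \<phi>_def)
    then show ?thesis
      using \<rho>(2)[OF e(2)] \<rho>(2)[OF e(3)] by simp
  qed
  then have "\<not> \<bar>\<rho>\<bar> < a" by blast
  then have "\<bar>\<rho>\<bar> = a" using \<rho>(1) by (auto simp: abs_if split: if_splits)
  then have "\<phi> \<rho> = \<phi> a" by (auto simp: \<phi>_def abs_if split: if_splits)
  then have "\<phi> (u - s) < \<phi> a"
    using not_max[of "u - s"] \<open>\<phi> \<rho> = \<phi> a\<close> assms(4-6) by (simp add: a_def u_def field_simps)
  moreover have "u + (u - s) = t" "u - (u - s) = s" "u + a = t'" "u - a = s'"
    using assms(6) by (auto simp: a_def u_def field_simps)
  ultimately show ?thesis
    by (simp add: \<phi>_def)
qed

text \<open>The inner points are convex combinations of the outer ones with exchanged weights, so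
  adding the two convexity inequalities suffices. It will be applied to the negative of a concave
  function.\<close>

lemma convex_on_spread:
  fixes f :: "real \<Rightarrow> real"
  assumes f: "convex_on I f" and "s' \<in> I" "t' \<in> I" "s' \<le> s" "s \<le> t'" "s + t = s' + t'"
  shows "f s + f t \<le> f s' + f t'"
proof (cases "s' = t'")
  case True
  then show ?thesis using assms by auto
next
  case False
  define w where "w = (s - s') / (t' - s')"
  have "s' < t'" using False assms by auto
  then have w: "0 \<le> w" "w \<le> 1" and wd: "w * (t' - s') = s - s'"
    using assms by (auto simp: w_def)
  have s: "s = (1 - w) * s' + w * t'" and t: "t = w * s' + (1 - w) * t'"
    using wd assms(6) by (auto simp: algebra_simps)
  have "f s \<le> (1 - w) * f s' + w * f t'" "f t \<le> w * f s' + (1 - w) * f t'"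
    unfolding s t
    using convex_onD[OF f, of w s' t'] convex_onD[OF f, of "1 - w" s' t'] w assms(2,3) by auto
  then show ?thesis
    by (simp add: algebra_simps)
qed

section \<open>The failure of strict convexity for a smooth function\<close>

text \<open>If no interval carried \<open>h'' \<le> 0\<close>, then \<open>h''\<close> would be nonnegative and \<open>h'\<close> strictly
  increasing.\<close>

lemma not_strictly_convex_pos_imp_concave:
  fixes h :: "real \<Rightarrow> real"
  assumes h: "\<And>t. 0 < t \<Longrightarrow> (h has_real_derivative h' t) (at t)"
    and h': "\<And>t. 0 < t \<Longrightarrow> (h' has_real_derivative h'' t) (at t)"
    and cont: "continuous_on {0<..} h''"
    and ncvx: "\<not> strictly_convex_pos h"
  obtains l u where "0 < l" "l < u" "convex_on {l<..<u} (\<lambda>t. - h t)"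
proof -
  have "\<exists>l u. 0 < l \<and> l < u \<and> (\<forall>t\<in>{l<..<u}. h'' t \<le> 0)"
  proof (rule ccontr)
    assume *: "\<nexists>l u. 0 < l \<and> l < u \<and> (\<forall>t\<in>{l<..<u}. h'' t \<le> 0)"
    have nonneg: "0 \<le> h'' t" if "0 < t" for t
    proof (rule ccontr)
      assume "\<not> 0 \<le> h'' t"
      moreover have "isCont h'' t"
        using cont that by (simp add: continuous_on_eq_continuous_at)
      ultimately have "\<forall>\<^sub>F s in at t. h'' s < 0"
        by (intro order_tendstoD(2)[of h'' "h'' t"]) (auto simp: isCont_def)
      then obtain d where d: "d > 0" "\<And>s. s \<noteq> t \<Longrightarrow> dist s t < d \<Longrightarrow> h'' s < 0"
        by (auto simp: eventually_at)
      then have "\<forall>s\<in>{t<..<t + d}. h'' s \<le> 0"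
        by (force simp: dist_real_def)
      then show False
        using * that d(1) by (metis less_add_same_cancel1)
    qed
    have mono: "h' s \<le> h' t" if "0 < s" "s \<le> t" for s t
      using that nonneg h'
      by (intro DERIV_nonneg_imp_nondecreasing[of s t h']) (meson less_le_trans)+
    \<comment> \<open>Otherwise the monotone \<open>h'\<close> would be constant between
      \<open>s\<close> and \<open>t\<close>, and \<open>h''\<close> would vanish there, contrary to
      \<open>*\<close>.\<close>
    have strict: "h' s < h' t" if st: "0 < s" "s < t" for s t
    proof (rule ccontr)
      assume "\<not> h' s < h' t"
      then have eq: "h' r = h' s" if "r \<in> {s<..<t}" for r
        using that st mono[of s r] mono[of r t] by auto
      have "h'' r = 0" if r: "r \<in> {s<..<t}" for r
      proof -
        have "(h' has_real_derivative h'' r) (at r)"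
          using h' r st by auto
        then have "((\<lambda>_. h' s) has_real_derivative h'' r) (at r)"
          by (rule has_field_derivative_transform_within_open[of _ _ _ "{s<..<t}"])
             (use r eq in auto)
        then show ?thesis
          by (metis DERIV_const DERIV_unique)
      qed
      then show False
        using * st by (metis order_refl)
    qed
    \<comment> \<open>The mean value theorem on the two halves reduces the midpoint inequality to
      the strict growth of \<open>h'\<close>.\<close>
    have "2 * h ((s + t) / 2) < h s + h t" if st: "0 < s" "s < t" for s t
    proof -
      define m where "m = (s + t) / 2"
      have m: "s < m" "m < t" "t - m = m - s"
        using st by (auto simp: m_def field_simps)
      obtain a where a: "s < a" "a < m" "h m - h s = (m - s) * h' a"
        using MVT2[OF m(1), of h h'] h st by auto
      obtain b where b: "m < b" "b < t" "h t - h m = (t - m) * h' b"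
        using MVT2[OF m(2), of h h'] h st m by auto
      have "h' a < h' b"
        using strict a b st by auto
      then have "(m - s) * h' a < (t - m) * h' b"
        using m by simp
      then show ?thesis
        using a b by (simp add: m_def)
    qed
    then have "strictly_convex_pos h"
      unfolding strictly_convex_pos_def by (metis add.commute linorder_neqE)
    then show False using ncvx by blast
  qed
  then obtain l u where lu: "0 < l" "l < u" "\<And>t. t \<in> {l<..<u} \<Longrightarrow> h'' t \<le> 0"
    by auto
  have "convex_on {l<..<u} (\<lambda>t. - h t)"
  proof (rule f''_ge0_imp_convex)
    show "((\<lambda>t. - h t) has_real_derivative - h' x) (at x)" if "x \<in> {l<..<u}" for x
      using that lu(1) by (auto intro!: derivative_intros h)
    show "((\<lambda>t. - h' t) has_real_derivative - h'' x) (at x)" if "x \<in> {l<..<u}" for x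
      using that lu(1) by (auto intro!: derivative_intros h')
  qed (use lu in auto)
  then show ?thesis
    using that lu by blast
qed

lemma C2_pos_comp_sqrt:
  assumes "C2_pos K"
  shows "C2_pos (\<lambda>t. K (sqrt t))"
proof -
  obtain K' K'' where
    K: "\<And>t. 0 < t \<Longrightarrow> (K has_real_derivative K' t) (at t)"
    and K': "\<And>t. 0 < t \<Longrightarrow> (K' has_real_derivative K'' t) (at t)"
    and cont: "continuous_on {0<..} K''"
    using assms by (auto simp: C2_pos_def)
  have cK': "continuous_on {0<..} K'"
    using K' by (auto intro!: continuous_at_imp_continuous_on DERIV_isCont)
  define f where "f t = K' (sqrt t) * (inverse (sqrt t) / 2)" for t
  \<comment> \<open>The second derivative in the unsimplified shape produced by the product, chain
    and inverse rules.\<close>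
  define g where "g t = K'' (sqrt t) * (inverse (sqrt t) / 2) * (inverse (sqrt t) / 2)
      + K' (sqrt t) * (- (inverse (sqrt t) * (inverse (sqrt t) / 2) * inverse (sqrt t)) / 2)" for t
  have "((\<lambda>t. K (sqrt t)) has_real_derivative f t) (at t)" if "0 < t" for t
    unfolding f_def using that by (intro DERIV_chain2[OF K] DERIV_real_sqrt) auto
  moreover have "(f has_real_derivative g t) (at t)" if "0 < t" for t
  proof -
    have "((\<lambda>t. K' (sqrt t)) has_real_derivative K'' (sqrt t) * (inverse (sqrt t) / 2)) (at t)"
      using that by (intro DERIV_chain2[OF K'] DERIV_real_sqrt) auto
    moreover have "((\<lambda>t. inverse (sqrt t) / 2) has_real_derivative
        - (inverse (sqrt t) * (inverse (sqrt t) / 2) * inverse (sqrt t)) / 2) (at t)"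
      using that by (intro DERIV_cdivide DERIV_inverse' DERIV_real_sqrt) auto
    ultimately show ?thesis
      unfolding f_def g_def by (auto dest: DERIV_mult simp: mult.commute add.commute)
  qed
  moreover have "continuous_on {0<..} g"
    unfolding g_def
    by (intro continuous_intros continuous_on_compose2[OF cont] continuous_on_compose2[OF cK'])
       auto
  ultimately show ?thesis
    unfolding C2_pos_def by blast
qed

section \<open>Haar measures on the group\<close>

text \<open>On \<open>O2\<close> this is the group inverse. Being a transpose, it is continuous and
  an involution on all pairs of matrices.\<close>

definition inv2 :: "('m::finite) matrix2 \<Rightarrow> 'm matrix2" where
  "inv2 R = (transpose (fst R), transpose (snd R))"

lemma mult2_O2: "R \<in> O2 \<Longrightarrow> S \<in> O2 \<Longrightarrow> mult2 R S \<in> O2"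
  by (simp add: O2_def mult2_def orthogonal_matrix_mul)

lemma inv2_O2: "R \<in> O2 \<Longrightarrow> inv2 R \<in> O2"
  by (simp add: O2_def inv2_def)

lemma mult2_assoc: "mult2 (mult2 R S) T = mult2 R (mult2 S T)"
  by (simp add: mult2_def matrix_mul_assoc)

lemma inv2_mult2: "inv2 (mult2 R S) = mult2 (inv2 S) (inv2 R)"
  by (simp add: mult2_def inv2_def matrix_transpose_mul)

lemma inv2_inv2: "inv2 (inv2 R) = R"
  by (simp add: inv2_def)

lemma mult2_inv2_cancel:
  assumes "R \<in> O2"
  shows "mult2 (inv2 R) (mult2 R S) = S" "mult2 R (mult2 (inv2 R) S) = S"
  using assms by (simp_all add: O2_def mult2_def inv2_def matrix_mul_assoc orthogonal_matrix_def)

section \<open>Continuity and measurability of the group operations\<close>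

lemma continuous_on_mult2 [continuous_intros]:
  "continuous_on A f \<Longrightarrow> continuous_on A g \<Longrightarrow> continuous_on A (\<lambda>x. mult2 (f x) (g x))"
  unfolding mult2_def matrix_matrix_mult_def by (intro continuous_intros)

lemma continuous_on_inv2 [continuous_intros]:
  "continuous_on A f \<Longrightarrow> continuous_on A (\<lambda>x. inv2 (f x))"
  unfolding inv2_def transpose_def by (intro continuous_intros)

lemma haar_O2D:
  assumes "haar_O2 \<mu>"
  shows "sets \<mu> = sets (restrict_space borel O2)" "space \<mu> = O2" "finite_measure \<mu>"
    "emeasure \<mu> O2 \<noteq> 0" "emeasure \<mu> O2 \<noteq> \<infinity>"
    "\<And>R A. R \<in> O2 \<Longrightarrow> A \<in> sets \<mu> \<Longrightarrow> emeasure \<mu> (mult2 R ` A) = emeasure \<mu> A"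
proof -
  show 1: "sets \<mu> = sets (restrict_space borel O2)" "finite_measure \<mu>" "emeasure \<mu> O2 \<noteq> 0"
    "\<And>R A. R \<in> O2 \<Longrightarrow> A \<in> sets \<mu> \<Longrightarrow> emeasure \<mu> (mult2 R ` A) = emeasure \<mu> A"
    using assms by (auto simp: haar_O2_def)
  show "space \<mu> = O2"
    using sets_eq_imp_space_eq[OF 1(1)] by (simp add: space_restrict_space)
  then show "emeasure \<mu> O2 \<noteq> \<infinity>"
    using finite_measure.emeasure_finite[OF 1(2), of O2] by simp
qed

lemma measurable_into_O2:
  assumes "sets \<nu> = sets (restrict_space borel O2)" "f \<in> borel_measurable M"
    and "\<And>x. x \<in> space M \<Longrightarrow> f x \<in> O2"
  shows "f \<in> M \<rightarrow>\<^sub>M \<nu>"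
  unfolding measurable_cong_sets[OF refl assms(1)]
  by (rule measurable_restrict_space2) (use assms in auto)

lemma borel_measurable_haar_continuous:
  assumes "haar_O2 \<mu>" "continuous_on UNIV f"
  shows "f \<in> borel_measurable \<mu>"
  unfolding measurable_cong_sets[OF haar_O2D(1)[OF assms(1)] refl]
  by (intro measurable_restrict_space1 borel_measurable_continuous_onI assms(2))

lemma measurable_haar_continuous:
  assumes "haar_O2 \<mu>" "haar_O2 \<nu>" "continuous_on UNIV f" "\<And>R. R \<in> O2 \<Longrightarrow> f R \<in> O2"
  shows "f \<in> \<mu> \<rightarrow>\<^sub>M \<nu>"
proof (rule measurable_into_O2[OF haar_O2D(1)[OF assms(2)]])
  show "f \<in> borel_measurable \<mu>"
    by (rule borel_measurable_haar_continuous[OF assms(1,3)])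
qed (simp only: assms(4) haar_O2D(2)[OF assms(1)])

lemma haar_distr_mult2_left:
  assumes h: "haar_O2 \<mu>" and R: "R \<in> O2"
  shows "distr \<mu> \<mu> (mult2 R) = \<mu>"
proof (rule measure_eqI)
  have m: "mult2 S \<in> \<mu> \<rightarrow>\<^sub>M \<mu>" if "S \<in> O2" for S
    using that by (intro measurable_haar_continuous[OF h h] continuous_intros mult2_O2)
  fix A assume "A \<in> sets (distr \<mu> \<mu> (mult2 R))"
  then have A: "A \<in> sets \<mu>" by simp
  have "A \<subseteq> O2"
    using sets.sets_into_space[OF A] haar_O2D(2)[OF h] by simp
  \<comment> \<open>\<open>haar_O2\<close> states invariance through images; the preimage under
    \<open>R\<close> is the image under its inverse.\<close>
  then have "mult2 R -` A \<inter> O2 = mult2 (inv2 R) ` A"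
    using R by (force simp: mult2_inv2_cancel mult2_O2 inv2_O2
        intro: image_eqI[of _ _ "mult2 R x" for x])
  then show "emeasure (distr \<mu> \<mu> (mult2 R)) A = emeasure \<mu> A"
    using haar_O2D(6)[OF h inv2_O2[OF R] A] A m[OF R]
    by (simp add: emeasure_distr haar_O2D(2)[OF h])
qed simp

lemma nn_integral_haar_mult2_left:
  assumes h: "haar_O2 \<mu>" and "R \<in> O2" "f \<in> borel_measurable \<mu>"
  shows "(\<integral>\<^sup>+ S. f (mult2 R S) \<partial>\<mu>) = (\<integral>\<^sup>+ S. f S \<partial>\<mu>)"
proof -
  have "mult2 R \<in> \<mu> \<rightarrow>\<^sub>M \<mu>"
    using assms by (intro measurable_haar_continuous[OF h h] continuous_intros mult2_O2)
  then have "(\<integral>\<^sup>+ S. f (mult2 R S) \<partial>\<mu>) = (\<integral>\<^sup>+ S. f S \<partial>distr \<mu> \<mu> (mult2 R))"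
    using assms by (simp add: nn_integral_distr)
  then show ?thesis
    by (simp add: haar_distr_mult2_left assms)
qed

text \<open>Both sides are the double integral of the indicator of \<open>A\<close> at \<open>S\<inverse> R\<close>.\<close>

lemma haar_emeasure_inv2:
  fixes \<mu> \<nu> :: "('m::finite) matrix2 measure"
  assumes h: "haar_O2 \<mu>" and k: "haar_O2 \<nu>" and A: "A \<in> sets \<mu>"
  shows "emeasure \<mu> A * emeasure \<nu> O2 = emeasure \<nu> (inv2 -` A \<inter> O2) * emeasure \<mu> O2"
proof -
  interpret \<mu>: finite_measure \<mu> by (rule haar_O2D(3)[OF h])
  interpret \<nu>: finite_measure \<nu> by (rule haar_O2D(3)[OF k])
  interpret pair_sigma_finite \<nu> \<mu> ..
  have sp: "space \<mu> = O2" "space \<nu> = O2"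
    using haar_O2D(2) h k by auto
  have id: "(\<lambda>R. R) \<in> borel_measurable \<mu>" "(\<lambda>R. R) \<in> borel_measurable \<nu>"
    using h k by (auto intro: borel_measurable_haar_continuous)
  have "(\<lambda>p. (fst p, snd p)) \<in> borel_measurable (\<nu> \<Otimes>\<^sub>M \<mu>)"
    by (intro borel_measurable_Pair measurable_compose[OF measurable_fst id(2)]
        measurable_compose[OF measurable_snd id(1)])
  then have "(\<lambda>p. mult2 (inv2 (fst p)) (snd p)) \<in> borel_measurable (\<nu> \<Otimes>\<^sub>M \<mu>)"
    by (intro borel_measurable_continuous_on[of "\<lambda>p. mult2 (inv2 (fst p)) (snd p)" "\<lambda>p. p"]
        continuous_intros) simp
  then have mm: "(\<lambda>p. mult2 (inv2 (fst p)) (snd p)) \<in> \<nu> \<Otimes>\<^sub>M \<mu> \<rightarrow>\<^sub>M \<mu>"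
    by (intro measurable_into_O2[OF haar_O2D(1)[OF h]])
       (use sp in \<open>simp_all add: space_pair_measure mem_Times_iff mult2_O2 inv2_O2\<close>)
  have inv: "inv2 \<in> \<nu> \<rightarrow>\<^sub>M \<mu>"
    by (intro measurable_haar_continuous[OF k h] continuous_intros inv2_O2)
  let ?f = "\<lambda>R. indicator A R :: ennreal"
  have f: "?f \<in> borel_measurable \<mu>"
    using A by simp
  have ff: "(\<lambda>(S, R). ?f (mult2 (inv2 S) R)) \<in> borel_measurable (\<nu> \<Otimes>\<^sub>M \<mu>)"
    using measurable_compose[OF mm f] by (simp add: case_prod_beta)
  have "(\<integral>\<^sup>+ S. (\<integral>\<^sup>+ R. ?f (mult2 (inv2 S) R) \<partial>\<mu>) \<partial>\<nu>) = (\<integral>\<^sup>+ S. emeasure \<mu> A \<partial>\<nu>)"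
    using A f by (intro nn_integral_cong) (simp add: nn_integral_haar_mult2_left h inv2_O2 sp)
  also have "\<dots> = emeasure \<mu> A * emeasure \<nu> O2"
    by (simp add: sp)
  finally have 1: "(\<integral>\<^sup>+ S. (\<integral>\<^sup>+ R. ?f (mult2 (inv2 S) R) \<partial>\<mu>) \<partial>\<nu>) = emeasure \<mu> A * emeasure \<nu> O2" .
  have "(\<integral>\<^sup>+ S. ?f (mult2 (inv2 S) R) \<partial>\<nu>) = emeasure \<nu> (inv2 -` A \<inter> O2)" if R: "R \<in> O2" for R
  proof -
    \<comment> \<open>For fixed \<open>R\<close> the argument is the inverse of
      \<open>mult2 (inv2 R) S\<close>, so left invariance of \<open>\<nu>\<close> removes
      \<open>R\<close>.\<close>
    have "(\<integral>\<^sup>+ S. ?f (mult2 (inv2 S) R) \<partial>\<nu>) = (\<integral>\<^sup>+ S. ?f (inv2 (mult2 (inv2 R) S)) \<partial>\<nu>)"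
      by (simp add: inv2_mult2 inv2_inv2)
    also have "\<dots> = (\<integral>\<^sup>+ S. ?f (inv2 S) \<partial>\<nu>)"
      by (rule nn_integral_haar_mult2_left[OF k inv2_O2[OF R] measurable_compose[OF inv f]])
    also have "\<dots> = (\<integral>\<^sup>+ S. indicator (inv2 -` A \<inter> O2) S \<partial>\<nu>)"
      by (intro nn_integral_cong) (auto simp: sp split: split_indicator)
    also have "\<dots> = emeasure \<nu> (inv2 -` A \<inter> O2)"
      using measurable_sets[OF inv A] by (simp add: sp)
    finally show ?thesis .
  qed
  then have "(\<integral>\<^sup>+ R. (\<integral>\<^sup>+ S. ?f (mult2 (inv2 S) R) \<partial>\<nu>) \<partial>\<mu>)
      = (\<integral>\<^sup>+ R. emeasure \<nu> (inv2 -` A \<inter> O2) \<partial>\<mu>)"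
    by (intro nn_integral_cong) (simp add: sp)
  also have "\<dots> = emeasure \<nu> (inv2 -` A \<inter> O2) * emeasure \<mu> O2"
    by (simp add: sp)
  finally show ?thesis
    using Fubini[OF ff] 1 by simp
qed

text \<open>Comparing \<open>\<mu>\<close> with \<open>\<nu>\<close>, and \<open>\<nu>\<close> with
  itself, in \<open>haar_emeasure_inv2\<close> gives the same right-hand side; the total mass,
  neither zero nor infinite, then cancels.\<close>

lemma haar_O2_unique:
  assumes h: "haar_O2 \<mu>" and k: "haar_O2 \<nu>" and eq: "emeasure \<mu> O2 = emeasure \<nu> O2"
  shows "\<mu> = \<nu>"
proof (rule measure_eqI)
  show sets: "sets \<mu> = sets \<nu>"
    using haar_O2D(1) h k by auto
  fix A assume A: "A \<in> sets \<mu>"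
  have "emeasure \<nu> O2 * emeasure \<nu> A = emeasure \<nu> O2 * emeasure \<mu> A"
    using haar_emeasure_inv2[OF h k A] haar_emeasure_inv2[OF k k] A sets eq
    by (simp add: mult.commute)
  then show "emeasure \<mu> A = emeasure \<nu> A"
    using haar_O2D(4,5)[OF k] by (simp add: ennreal_mult_cancel_left)
qed

text \<open>By \<open>equiv\<close>, left translations pass through \<open>T\<close> to left
  translations. Hence the image measure under \<open>T\<close> is again a Haar measure of the same
  mass, and uniqueness identifies it with \<open>\<mu>\<close>.\<close>

lemma haar_nn_integral_transform:
  assumes h: "haar_O2 \<mu>" and T: "continuous_on UNIV T" "\<And>R. R \<in> O2 \<Longrightarrow> T R \<in> O2"
    and equiv: "\<And>S. S \<in> O2 \<Longrightarrow> \<exists>S'\<in>O2. \<forall>R\<in>O2. mult2 S (T R) = T (mult2 S' R)"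
    and f: "f \<in> borel_measurable \<mu>"
  shows "(\<integral>\<^sup>+ R. f (T R) \<partial>\<mu>) = (\<integral>\<^sup>+ R. f R \<partial>\<mu>)"
proof -
  have Tm: "T \<in> \<mu> \<rightarrow>\<^sub>M \<mu>"
    by (rule measurable_haar_continuous[OF h h T])
  have sp: "space \<mu> = O2"
    by (rule haar_O2D(2)[OF h])
  have left: "emeasure (distr \<mu> \<mu> T) (mult2 R ` A) = emeasure (distr \<mu> \<mu> T) A"
    if R: "R \<in> O2" and A: "A \<in> sets \<mu>" for R A
  proof -
    have sub: "A \<subseteq> O2"
      using sets.sets_into_space[OF A] sp by simp
    obtain S' where S': "S' \<in> O2" "\<And>Q. Q \<in> O2 \<Longrightarrow> mult2 (inv2 R) (T Q) = T (mult2 S' Q)"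
      using equiv[OF inv2_O2[OF R]] by auto
    have eq: "mult2 R ` A = mult2 (inv2 R) -` A \<inter> O2"
      using R sub by (force simp: mult2_inv2_cancel mult2_O2 inv2_O2
          intro: image_eqI[of _ _ "mult2 (inv2 R) x" for x])
    have "mult2 (inv2 R) \<in> \<mu> \<rightarrow>\<^sub>M \<mu>"
      using R by (intro measurable_haar_continuous[OF h h] continuous_intros mult2_O2 inv2_O2)
    then have im: "mult2 R ` A \<in> sets \<mu>"
      unfolding eq using measurable_sets[of _ \<mu> \<mu> A] A sp by metis
    have TA: "T -` A \<inter> O2 \<in> sets \<mu>"
      using measurable_sets[OF Tm A] sp by simp
    have "T Q \<in> mult2 R ` A \<longleftrightarrow> mult2 S' Q \<in> T -` A \<inter> O2" if "Q \<in> O2" for Q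
      using S'(2)[OF that] T(2)[OF that] mult2_O2[OF S'(1) that] unfolding eq by simp
    then have "T -` (mult2 R ` A) \<inter> O2 = mult2 S' -` (T -` A \<inter> O2) \<inter> O2"
      by blast
    also have "emeasure \<mu> \<dots> = emeasure (distr \<mu> \<mu> (mult2 S')) (T -` A \<inter> O2)"
      using TA sp measurable_haar_continuous[OF h h continuous_on_mult2 mult2_O2[OF S'(1)]]
      by (subst emeasure_distr) auto
    finally show ?thesis
      using Tm im A S'(1) by (simp add: emeasure_distr sp haar_distr_mult2_left h)
  qed
  have tot: "emeasure (distr \<mu> \<mu> T) O2 = emeasure \<mu> O2"
  proof -
    have "T -` O2 \<inter> O2 = O2"
      using T(2) by blast
    then show ?thesis
      using emeasure_distr[OF Tm, of O2] sets.top[of \<mu>] sp by simp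
  qed
  have "haar_O2 (distr \<mu> \<mu> T)"
    unfolding haar_O2_def
    using left tot haar_O2D(1,4)[OF h] finite_measure.finite_measure_distr[OF haar_O2D(3)[OF h] Tm]
    by simp
  then have "distr \<mu> \<mu> T = \<mu>"
    by (rule haar_O2_unique[OF _ h tot])
  then show ?thesis
    using nn_integral_distr[OF Tm, of f] f by simp
qed

text \<open>This is where right invariance comes from, that is, unimodularity of the group.
  Translation by \<open>S\<close> passes through as translation by its conjugate by
  \<open>P\<close>.\<close>

lemma haar_nn_integral_two_sided:
  assumes h: "haar_O2 \<mu>" and "P \<in> O2" "Q \<in> O2" "f \<in> borel_measurable \<mu>"
  shows "(\<integral>\<^sup>+ R. f (mult2 P (mult2 R Q)) \<partial>\<mu>) = (\<integral>\<^sup>+ R. f R \<partial>\<mu>)"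
proof (rule haar_nn_integral_transform[OF h])
  show "continuous_on UNIV (\<lambda>R. mult2 P (mult2 R Q))"
    by (intro continuous_intros)
  fix S :: "'a matrix2" assume "S \<in> O2"
  then show "\<exists>S'\<in>O2. \<forall>R\<in>O2. mult2 S (mult2 P (mult2 R Q)) = mult2 P (mult2 (mult2 S' R) Q)"
    using assms by (intro bexI[of _ "mult2 (inv2 P) (mult2 S P)"])
      (simp_all add: mult2_assoc mult2_inv2_cancel mult2_O2 inv2_O2)
qed (use assms in \<open>auto simp: mult2_O2\<close>)

text \<open>Exchanging the two factors is a continuous automorphism of the group.\<close>

lemma haar_nn_integral_swap:
  assumes h: "haar_O2 \<mu>" and "f \<in> borel_measurable \<mu>"
  shows "(\<integral>\<^sup>+ R. f (prod.swap R) \<partial>\<mu>) = (\<integral>\<^sup>+ R. f R \<partial>\<mu>)"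
proof (rule haar_nn_integral_transform[OF h])
  show "continuous_on UNIV prod.swap"
    by (rule continuous_on_swap)
  fix S :: "'a matrix2" assume "S \<in> O2"
  then show "\<exists>S'\<in>O2. \<forall>R\<in>O2. mult2 S (prod.swap R) = prod.swap (mult2 S' R)"
    by (intro bexI[of _ "prod.swap S"]) (auto simp: O2_def mult2_def)
qed (use assms in \<open>auto simp: O2_def\<close>)

section \<open>The averaged kernel as a function of two cosines\<close>

lemma orthogonal_matrix_inner:
  fixes A :: "real ^ 'm ^ 'm"
  assumes "orthogonal_matrix A"
  shows "(A *v x) \<bullet> (A *v y) = x \<bullet> y"
proof -
  have "orthogonal_transformation ((*v) A)"
    using assms by (simp add: orthogonal_transformation_matrix matrix_vector_mul_linear)
  then show ?thesis
    by (simp add: orthogonal_transformation_def)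
qed

lemma orthogonal_matrix_norm:
  fixes A :: "real ^ 'm ^ 'm"
  shows "orthogonal_matrix A \<Longrightarrow> norm (A *v x) = norm x"
  by (simp add: norm_eq_sqrt_inner orthogonal_matrix_inner)

lemma orthogonal_matrix_exists:
  fixes a b :: "real ^ 'm"
  assumes "norm a = norm b"
  obtains A where "orthogonal_matrix A" "A *v a = b"
proof -
  obtain f where f: "orthogonal_transformation f" "f a = b"
    using orthogonal_transformation_exists[OF assms] .
  then have "linear f" "orthogonal_matrix (matrix f)"
    by (auto simp: orthogonal_transformation_matrix)
  with f show ?thesis
    by (intro that[of "matrix f"]) (auto simp: matrix_works)
qed

lemma act2_mult2: "act2 (mult2 R S) x = act2 R (act2 S x)"
  by (simp add: act2_def mult2_def matrix_vector_mul_assoc)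

lemma act2_diff: "act2 R (x - y) = act2 R x - act2 R y"
  by (simp add: act2_def matrix_vector_mult_diff_distrib)

lemma norm_act2: "R \<in> O2 \<Longrightarrow> norm (act2 R x) = norm x"
  by (cases x) (simp add: act2_def O2_def norm_Pair orthogonal_matrix_norm)

lemma act2_inv2_cancel: "R \<in> O2 \<Longrightarrow> act2 (inv2 R) (act2 R x) = x"
  by (cases x) (simp add: act2_def O2_def inv2_def orthogonal_matrix_def matrix_vector_mul_assoc
      del: transpose_matrix_vector)

lemma continuous_on_act2 [continuous_intros]:
  "continuous_on A f \<Longrightarrow> continuous_on A (\<lambda>z. act2 (f z) x)"
  unfolding act2_def matrix_vector_mult_def by (intro continuous_intros)

text \<open>Every orbit meets the plane spanned by \<open>(e, 0)\<close> and \<open>(0, e)\<close>.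
  The same \<open>e\<close> serves both factors and all points, so only norms will matter.\<close>

lemma act2_exists:
  fixes x :: "('m::finite) space2"
  assumes "norm e = 1"
  obtains A where "A \<in> O2" "act2 A (norm (fst x) *\<^sub>R e, norm (snd x) *\<^sub>R e) = x"
proof -
  have "norm (norm v *\<^sub>R e) = norm v" for v :: "real ^ 'm"
    using assms by simp
  note ex = orthogonal_matrix_exists[OF this]
  obtain A1 where A1: "orthogonal_matrix A1" "A1 *v (norm (fst x) *\<^sub>R e) = fst x"
    using ex .
  obtain A2 where A2: "orthogonal_matrix A2" "A2 *v (norm (snd x) *\<^sub>R e) = snd x"
    using ex .
  show ?thesis
    by (rule that[of "(A1, A2)"]) (simp_all add: O2_def act2_def A1 A2)
qed

text \<open>For a unit vector \<open>e\<close> and an orthogonal \<open>A\<close> this is the cosine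
  of the angle between \<open>e\<close> and its image.\<close>

definition cosine :: "real ^ 'm \<Rightarrow> real ^ 'm ^ 'm \<Rightarrow> real" where
  "cosine e A = (A *v e) \<bullet> e"

lemma continuous_on_cosine [continuous_intros]:
  "continuous_on S f \<Longrightarrow> continuous_on S (\<lambda>z. cosine e (f z))"
  unfolding cosine_def matrix_vector_mult_def by (intro continuous_intros)

lemma cosine_bound:
  "orthogonal_matrix A \<Longrightarrow> norm e = 1 \<Longrightarrow> \<bar>cosine e A\<bar> \<le> 1"
  using Cauchy_Schwarz_ineq2[of "A *v e" e] by (simp add: cosine_def orthogonal_matrix_norm)

lemma norm_act2_diff_axis:
  fixes e :: "real ^ 'm"
  assumes "R \<in> O2" "norm e = 1"
  shows "norm (act2 R (p *\<^sub>R e, q *\<^sub>R e) - (r *\<^sub>R e, s *\<^sub>R e)) =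
    sqrt (p\<^sup>2 + q\<^sup>2 + r\<^sup>2 + s\<^sup>2 - 2 * (p * r * cosine e (fst R) + q * s * cosine e (snd R)))"
proof -
  have *: "(norm (p *\<^sub>R (A *v e) - r *\<^sub>R e))\<^sup>2 = p\<^sup>2 + r\<^sup>2 - 2 * (p * r * cosine e A)"
    if "orthogonal_matrix A" for A :: "real ^ 'm ^ 'm" and p r
  proof -
    have "e \<bullet> e = 1" "(A *v e) \<bullet> (A *v e) = 1"
      using assms(2) orthogonal_matrix_inner[OF that] by (simp_all add: norm_eq_1)
    then show ?thesis
      unfolding power2_norm_eq_inner
      by (simp add: inner_diff_left inner_diff_right inner_commute cosine_def power2_eq_square
          algebra_simps)
  qed
  have "orthogonal_matrix (fst R)" "orthogonal_matrix (snd R)"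
    using assms(1) by (auto simp: O2_def)
  then show ?thesis
    by (simp add: act2_def norm_Pair matrix_vector_mult_scaleR * algebra_simps)
qed

text \<open>Moving \<open>x\<close> and \<open>y\<close> to the axis points \<open>x0\<close> and
  \<open>y0\<close> replaces \<open>R\<close> by a two-sided translate, which leaves the Haar
  integral unchanged. The law of cosines in each factor does the rest.\<close>

lemma Kbar_eq_cosine_integral:
  fixes \<mu> :: "('m::finite) matrix2 measure" and e :: "real ^ 'm"
  assumes h: "haar_O2 \<mu>" and e: "norm e = 1"
    and meas: "(\<lambda>t. ext0 K (sqrt t)) \<in> borel_measurable borel"
  shows "Kbar \<mu> K x y =
    (\<integral>\<^sup>+ R. ext0 K (sqrt ((norm (fst x))\<^sup>2 + (norm (snd x))\<^sup>2 + (norm (fst y))\<^sup>2 + (norm (snd y))\<^sup>2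
      - 2 * (norm (fst x) * norm (fst y) * cosine e (fst R)
           + norm (snd x) * norm (snd y) * cosine e (snd R)))) \<partial>\<mu>) / emeasure \<mu> O2"
proof -
  define x0 where "x0 = (norm (fst x) *\<^sub>R e, norm (snd x) *\<^sub>R e)"
  define y0 where "y0 = (norm (fst y) *\<^sub>R e, norm (snd y) *\<^sub>R e)"
  obtain A where A: "A \<in> O2" "act2 A x0 = x"
    unfolding x0_def using act2_exists[OF e] .
  obtain B where B: "B \<in> O2" "act2 B y0 = y"
    unfolding y0_def using act2_exists[OF e] .
  have sp: "space \<mu> = O2"
    by (rule haar_O2D(2)[OF h])
  have "(\<lambda>R. (norm (act2 R x0 - y0))\<^sup>2) \<in> borel_measurable \<mu>"
    by (intro borel_measurable_haar_continuous[OF h] continuous_intros)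
  from measurable_compose[OF this meas]
  have m: "(\<lambda>R. ext0 K (norm (act2 R x0 - y0))) \<in> borel_measurable \<mu>"
    by simp
  have "(\<integral>\<^sup>+ R. ext0 K (norm (act2 R x - y)) \<partial>\<mu>)
      = (\<integral>\<^sup>+ R. ext0 K (norm (act2 (mult2 (inv2 B) (mult2 R A)) x0 - y0)) \<partial>\<mu>)"
  proof (intro nn_integral_cong)
    fix R
    have "act2 (inv2 B) (act2 R x - y) = act2 (mult2 (inv2 B) (mult2 R A)) x0 - y0"
      using A B by (simp add: act2_mult2 act2_diff flip: B(2))
        (simp add: act2_inv2_cancel)
    then show "ext0 K (norm (act2 R x - y))
        = ext0 K (norm (act2 (mult2 (inv2 B) (mult2 R A)) x0 - y0))"
      by (metis norm_act2 inv2_O2 B(1))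
  qed
  also have "\<dots> = (\<integral>\<^sup>+ R. ext0 K (norm (act2 R x0 - y0)) \<partial>\<mu>)"
    by (rule haar_nn_integral_two_sided[OF h inv2_O2[OF B(1)] A(1) m])
  finally show ?thesis
    unfolding Kbar_def x0_def y0_def
    using e by (simp add: norm_act2_diff_axis sp cong: nn_integral_cong_simp)
qed

section \<open>Symmetries and nondegeneracy of the pair of cosines\<close>

lemma uminus_mat_mult_vec: "(- mat 1 :: real ^ 'm ^ 'm) *v x = - x"
  using scaleR_matrix_vector_assoc[of "-1" "mat 1" x] by simp

lemma cosine_uminus_mat: "cosine e ((- mat 1) ** A) = - cosine e A"
  by (simp add: cosine_def uminus_mat_mult_vec flip: matrix_vector_mul_assoc)

text \<open>Left multiplication by \<open>(- mat 1, mat 1)\<close> flips the first cosine and keeps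
  the second.\<close>

lemma haar_cosine_neg:
  fixes \<mu> :: "('m::finite) matrix2 measure"
  assumes h: "haar_O2 \<mu>"
    and m: "(\<lambda>R. \<phi> (cosine e (fst R)) (cosine e (snd R))) \<in> borel_measurable \<mu>"
  shows "(\<integral>\<^sup>+ R. \<phi> (- cosine e (fst R)) (cosine e (snd R)) \<partial>\<mu>) =
         (\<integral>\<^sup>+ R. \<phi> (cosine e (fst R)) (cosine e (snd R)) \<partial>\<mu>)"
proof -
  have "transpose (- mat 1) = (- mat 1 :: real ^ 'm ^ 'm)"
    by (auto simp: transpose_def mat_def vec_eq_iff)
  then have "transpose (- mat 1 :: real ^ 'm ^ 'm) ** (- mat 1) = mat 1"
    by (simp add: matrix_eq uminus_mat_mult_vec flip: matrix_vector_mul_assoc)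
  then have "(- mat 1, mat 1) \<in> (O2 :: 'm matrix2 set)"
    by (simp add: O2_def orthogonal_matrix orthogonal_matrix_id)
  from nn_integral_haar_mult2_left[OF h this m] show ?thesis
    by (simp add: mult2_def cosine_uminus_mat)
qed

lemma haar_cosine_swap:
  assumes h: "haar_O2 \<mu>"
    and m: "(\<lambda>R. \<phi> (cosine e (fst R)) (cosine e (snd R))) \<in> borel_measurable \<mu>"
  shows "(\<integral>\<^sup>+ R. \<phi> (cosine e (snd R)) (cosine e (fst R)) \<partial>\<mu>) =
         (\<integral>\<^sup>+ R. \<phi> (cosine e (fst R)) (cosine e (snd R)) \<partial>\<mu>)"
  using haar_nn_integral_swap[OF h m] by simp

text \<open>The source of strictness in the comparison of averages. A left translation taking the
  \<open>i\<close>-th basis vector to \<open>e\<close> turns the cosine into the \<open>i\<close>-th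
  coordinate of the image of \<open>e\<close>; if all of these vanished almost everywhere, the image
  could not be a unit vector.\<close>

lemma cosine_not_AE_zero:
  fixes \<mu> :: "('m::finite) matrix2 measure" and e :: "real ^ 'm"
  assumes h: "haar_O2 \<mu>" and e: "norm e = 1"
  shows "\<not> (AE R in \<mu>. cosine e (fst R) = 0)"
proof
  assume AE: "AE R in \<mu>. cosine e (fst R) = 0"
  have sp: "space \<mu> = O2"
    by (rule haar_O2D(2)[OF h])
  have m: "(\<lambda>R. ennreal \<bar>cosine e (fst R)\<bar>) \<in> borel_measurable \<mu>"
    by (intro measurable_compose[OF _ measurable_ennreal] borel_measurable_haar_continuous[OF h]
        continuous_intros)
  have zero: "(\<integral>\<^sup>+ R. ennreal \<bar>(fst R *v e) $ i\<bar> \<partial>\<mu>) = 0" for i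
  proof -
    obtain B where B: "orthogonal_matrix B" "B *v axis i 1 = e"
      using orthogonal_matrix_exists_basis[OF e] .
    have "cosine e (B ** A) = (A *v e) $ i" for A
    proof -
      have "cosine e (B ** A) = (B *v (A *v e)) \<bullet> (B *v axis i 1)"
        by (simp add: cosine_def B(2) matrix_vector_mul_assoc)
      also have "\<dots> = (A *v e) $ i"
        by (simp add: orthogonal_matrix_inner[OF B(1)] inner_axis)
      finally show ?thesis .
    qed
    moreover have "(B, mat 1) \<in> O2"
      using B by (simp add: O2_def orthogonal_matrix_id)
    ultimately have "(\<integral>\<^sup>+ R. ennreal \<bar>(fst R *v e) $ i\<bar> \<partial>\<mu>)
        = (\<integral>\<^sup>+ R. ennreal \<bar>cosine e (fst R)\<bar> \<partial>\<mu>)"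
      using nn_integral_haar_mult2_left[OF h _ m, of "(B, mat 1)"] by (simp add: mult2_def)
    also have "\<dots> = 0"
      using AE by (subst nn_integral_0_iff_AE[OF m]) simp
    finally show ?thesis .
  qed
  have "emeasure \<mu> O2 = (\<integral>\<^sup>+ R. 1 \<partial>\<mu>)"
    by (simp add: sp)
  also have "\<dots> \<le> (\<integral>\<^sup>+ R. (\<Sum>i\<in>UNIV. ennreal \<bar>(fst R *v e) $ i\<bar>) \<partial>\<mu>)"
  proof (intro nn_integral_mono)
    fix R assume "R \<in> space \<mu>"
    then have "norm (fst R *v e) = 1"
      using e by (simp add: sp O2_def orthogonal_matrix_norm)
    then have "1 \<le> (\<Sum>i\<in>UNIV. \<bar>(fst R *v e) $ i\<bar>)"
      using norm_le_l1_cart[of "fst R *v e"] by simp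
    then show "1 \<le> (\<Sum>i\<in>UNIV. ennreal \<bar>(fst R *v e) $ i\<bar>)"
      by (subst sum_ennreal) auto
  qed
  also have "\<dots> = (\<Sum>i\<in>UNIV. \<integral>\<^sup>+ R. ennreal \<bar>(fst R *v e) $ i\<bar> \<partial>\<mu>)"
    by (intro nn_integral_sum measurable_compose[OF _ measurable_ennreal]
        borel_measurable_haar_continuous[OF h])
       (unfold matrix_vector_mult_def, intro continuous_intros)
  also have "\<dots> = 0"
    using zero by simp
  finally show False
    using haar_O2D(4)[OF h] by simp
qed

section \<open>Comparison of averages\<close>

lemma ennreal_double_le_iff: "x + x \<le> y + y \<longleftrightarrow> x \<le> (y::ennreal)"
  using ennreal_mult_le_mult_iff[of 2 x y] by (simp flip: mult_2)

lemma divide_ennreal_strict_right_mono: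
  fixes x y c :: ennreal
  assumes "x < y" "c \<noteq> 0" "c \<noteq> \<infinity>"
  shows "x / c < y / c"
proof (rule ccontr)
  assume "\<not> x / c < y / c"
  then have "y / c * c \<le> x / c * c"
    by (intro mult_right_mono) (auto simp: not_less)
  then show False
    using assms by (simp add: ennreal_divide_times ennreal_divide_self top.not_eq_extremum)
qed

lemma ennreal_double_less_iff: "x + x < y + y \<longleftrightarrow> x < (y::ennreal)"
  using ennreal_double_le_iff[of y x] by (simp add: not_le[symmetric])

text \<open>By the symmetries of the two cosines, the average of \<open>H (N - 2 (a \<alpha> + b \<beta>))\<close> is invariant
  under sign changes and exchange of \<open>a\<close> and \<open>b\<close>. The pair \<open>(c, d)\<close> is moved first to
  \<open>(a + b - d, d)\<close>, along a segment joining this pair to its reflection, and then to \<open>(a, b)\<close>,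
  along a segment joining that pair to \<open>(b, a)\<close>.\<close>

lemma cosine_average_less:
  fixes \<mu> :: "('m::finite) matrix2 measure" and e :: "real ^ 'm"
  assumes h: "haar_O2 \<mu>" and e: "norm e = 1" and H: "H \<in> borel_measurable borel"
    and spread: "\<And>s t s' t'. 0 \<le> s' \<Longrightarrow> 0 \<le> t' \<Longrightarrow> s + t = s' + t' \<Longrightarrow> \<bar>s - t\<bar> < \<bar>s' - t'\<bar>
      \<Longrightarrow> H s + H t < H s' + (H t' :: ennreal)"
    and ab: "0 \<le> b" "b \<le> d" "d \<le> a" "0 \<le> c" "c < a + b - d" "2 * (a + b) \<le> N"
    and fin: "(\<integral>\<^sup>+ R. H (N - 2 * (c * cosine e (fst R) + d * cosine e (snd R))) \<partial>\<mu>) \<noteq> \<infinity>"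
  shows "(\<integral>\<^sup>+ R. H (N - 2 * (c * cosine e (fst R) + d * cosine e (snd R))) \<partial>\<mu>)
    < (\<integral>\<^sup>+ R. H (N - 2 * (a * cosine e (fst R) + b * cosine e (snd R))) \<partial>\<mu>)"
proof -
  have sp: "space \<mu> = O2"
    by (rule haar_O2D(2)[OF h])
  \<comment> \<open>Equal sums and equal gaps force equal unordered pairs, which settles the
    boundary case.\<close>
  have spread_le: "H s + H t \<le> H s' + H t'"
    if "0 \<le> s'" "0 \<le> t'" "s + t = s' + t'" "\<bar>s - t\<bar> \<le> \<bar>s' - t'\<bar>" for s t s' t'
  proof (cases "\<bar>s - t\<bar> = \<bar>s' - t'\<bar>")
    case True
    then have "s = s' \<and> t = t' \<or> s = t' \<and> t = s'"
      using that(3) by (auto simp: abs_if split: if_splits)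
    then show ?thesis by (auto simp: add.commute)
  next
    case False
    then have "H s + H t < H s' + H t'"
      using that by (intro spread) auto
    then show ?thesis by (rule less_imp_le)
  qed
  \<comment> \<open>Keeps the outer arguments of \<open>H\<close> nonnegative, as
    \<open>spread\<close> demands.\<close>
  have bound: "2 * (p * u + q * v) \<le> N"
    if "\<bar>p\<bar> + \<bar>q\<bar> \<le> a + b" "\<bar>u\<bar> \<le> 1" "\<bar>v\<bar> \<le> 1" for p q u v :: real
  proof -
    have *: "x * y \<le> \<bar>x\<bar>" if "\<bar>y\<bar> \<le> 1" for x y :: real
    proof -
      have "x * y \<le> \<bar>x\<bar> * \<bar>y\<bar>"
        by (metis abs_ge_self abs_mult)
      also have "\<dots> \<le> \<bar>x\<bar>"
        using that by (simp add: mult_left_le)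
      finally show ?thesis .
    qed
    show ?thesis
      using *[OF that(2), of p] *[OF that(3), of q] that(1) ab(6) by simp
  qed
  let ?\<alpha> = "\<lambda>R :: 'm matrix2. cosine e (fst R)" and ?\<beta> = "\<lambda>R :: 'm matrix2. cosine e (snd R)"
  have cos: "\<bar>?\<alpha> R\<bar> \<le> 1" "\<bar>?\<beta> R\<bar> \<le> 1" if "R \<in> space \<mu>" for R
    using that e by (auto simp: sp O2_def cosine_bound)
  define F where "F p q u v = H (N - 2 * (p * u + q * v))" for p q u v
  have m: "(\<lambda>R. F p q (?\<alpha> R) (?\<beta> R)) \<in> borel_measurable \<mu>" for p q
    unfolding F_def
    by (intro measurable_compose[OF _ H] borel_measurable_haar_continuous[OF h] continuous_intros)
  have m1: "(\<lambda>R. F p q (- ?\<alpha> R) (?\<beta> R)) \<in> borel_measurable \<mu>"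
    and m2: "(\<lambda>R. F p q (?\<beta> R) (?\<alpha> R)) \<in> borel_measurable \<mu>" for p q
    unfolding F_def
    by (intro measurable_compose[OF _ H] borel_measurable_haar_continuous[OF h] continuous_intros)+
  define I where "I p q = (\<integral>\<^sup>+ R. F p q (?\<alpha> R) (?\<beta> R) \<partial>\<mu>)" for p q
  \<comment> \<open>Doubling the integral pairs each integrand with its mirror image, so that
    \<open>spread\<close> can be used pointwise.\<close>
  have neg: "I p q + I p q = (\<integral>\<^sup>+ R. F p q (?\<alpha> R) (?\<beta> R) + F p q (- ?\<alpha> R) (?\<beta> R) \<partial>\<mu>)" for p q
    using haar_cosine_neg[OF h m] by (simp add: nn_integral_add m m1 I_def)
  have swap: "I p q + I p q = (\<integral>\<^sup>+ R. F p q (?\<alpha> R) (?\<beta> R) + F p q (?\<beta> R) (?\<alpha> R) \<partial>\<mu>)" for p q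
    using haar_cosine_swap[OF h m] by (simp add: nn_integral_add m m2 I_def)
  \<comment> \<open>Chosen so that \<open>c' + d = a + b\<close>.\<close>
  define c' where "c' = a + b - d"
  have c': "c < c'" "0 \<le> c'" "\<bar>c'\<bar> + \<bar>d\<bar> \<le> a + b" "\<bar>a\<bar> + \<bar>b\<bar> \<le> a + b" "\<bar>c' - d\<bar> \<le> a - b"
    using ab by (auto simp: c'_def)
  have "I c d + I c d < I c' d + I c' d"
    unfolding neg
  proof (rule nn_integral_less)
    show "(\<integral>\<^sup>+ R. F c d (?\<alpha> R) (?\<beta> R) + F c d (- ?\<alpha> R) (?\<beta> R) \<partial>\<mu>) \<noteq> \<infinity>"
      using fin unfolding neg[symmetric] by (simp add: I_def F_def)
    have pos: "0 \<le> N - 2 * (c' * ?\<alpha> R + d * ?\<beta> R)" "0 \<le> N - 2 * (c' * - ?\<alpha> R + d * ?\<beta> R)"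
      if "R \<in> space \<mu>" for R
      using bound[OF c'(3) cos[OF that]] bound[OF c'(3), of "- ?\<alpha> R" "?\<beta> R"] cos[OF that] by auto
    \<comment> \<open>Flipping \<open>u\<close> keeps the sum of the two arguments independent of
      \<open>p\<close>, while their gap grows with the size of \<open>p\<close>, strictly so when
      \<open>u\<close> is nonzero.\<close>
    have gap: "N - 2 * (p * u + q * v) - (N - 2 * (p * - u + q * v)) = - 4 * (p * u)"
      for p q u v :: real by simp
    have gap_le: "\<bar>- 4 * (c * u)\<bar> \<le> \<bar>- 4 * (c' * u)\<bar>" for u :: real
      using c' ab(4) by (auto simp: abs_mult intro!: mult_right_mono)
    have gap_less: "\<bar>- 4 * (c * u)\<bar> < \<bar>- 4 * (c' * u)\<bar>" if "u \<noteq> 0" for u :: real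
      using c' ab(4) that by (auto simp: abs_mult)
    show "AE R in \<mu>. F c d (?\<alpha> R) (?\<beta> R) + F c d (- ?\<alpha> R) (?\<beta> R)
        \<le> F c' d (?\<alpha> R) (?\<beta> R) + F c' d (- ?\<alpha> R) (?\<beta> R)"
      unfolding F_def
      by (intro AE_I2 spread_le pos, assumption+, simp, unfold gap, rule gap_le)
    have less: "F c d (?\<alpha> R) (?\<beta> R) + F c d (- ?\<alpha> R) (?\<beta> R)
        < F c' d (?\<alpha> R) (?\<beta> R) + F c' d (- ?\<alpha> R) (?\<beta> R)"
      if "R \<in> space \<mu>" "?\<alpha> R \<noteq> 0" for R
      unfolding F_def
      by (intro spread pos that(1), simp, unfold gap, rule gap_less[OF that(2)])
    show "\<not> (AE R in \<mu>. F c' d (?\<alpha> R) (?\<beta> R) + F c' d (- ?\<alpha> R) (?\<beta> R)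
        \<le> F c d (?\<alpha> R) (?\<beta> R) + F c d (- ?\<alpha> R) (?\<beta> R))"
    proof
      assume "AE R in \<mu>. F c' d (?\<alpha> R) (?\<beta> R) + F c' d (- ?\<alpha> R) (?\<beta> R)
        \<le> F c d (?\<alpha> R) (?\<beta> R) + F c d (- ?\<alpha> R) (?\<beta> R)"
      then have "AE R in \<mu>. ?\<alpha> R = 0"
        using AE_space
      proof eventually_elim
        case (elim R)
        then show ?case
          using less[of R] by (meson not_le)
      qed
      then show False
        using cosine_not_AE_zero[OF h e] by blast
    qed
  qed (intro borel_measurable_add m m1)+
  moreover have "I c' d + I c' d \<le> I a b + I a b"
    unfolding swap
  proof (intro nn_integral_mono)
    fix R assume R: "R \<in> space \<mu>"
    \<comment> \<open>Under exchange the sum of the arguments depends only on \<open>p + q\<close>,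
      and their gap is proportional to the size of \<open>p - q\<close>.\<close>
    have gap: "N - 2 * (p * u + q * v) - (N - 2 * (p * v + q * u)) = - 2 * ((p - q) * (u - v))"
      for p q u v :: real by (simp add: algebra_simps)
    have sum: "N - 2 * (p * u + q * v) + (N - 2 * (p * v + q * u)) = 2 * N - 2 * ((p + q) * (u + v))"
      for p q u v :: real by (simp add: algebra_simps)
    have gap_le: "\<bar>- 2 * ((c' - d) * u)\<bar> \<le> \<bar>- 2 * ((a - b) * u)\<bar>" for u :: real
      using c'(5) ab by (auto simp: abs_mult intro!: mult_right_mono)
    have sum_eq: "c' + d = a + b"
      by (simp add: c'_def)
    show "F c' d (?\<alpha> R) (?\<beta> R) + F c' d (?\<beta> R) (?\<alpha> R) \<le> F a b (?\<alpha> R) (?\<beta> R) + F a b (?\<beta> R) (?\<alpha> R)"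
      unfolding F_def
    proof (rule spread_le)
      show "0 \<le> N - 2 * (a * ?\<alpha> R + b * ?\<beta> R)" "0 \<le> N - 2 * (a * ?\<beta> R + b * ?\<alpha> R)"
        using bound[OF c'(4) cos[OF R]] bound[OF c'(4) cos(2)[OF R] cos(1)[OF R]] by auto
    qed (simp_all only: gap gap_le sum sum_eq)
  qed
  ultimately have "I c d + I c d < I a b + I a b"
    by (rule less_le_trans)
  then show ?thesis
    by (simp add: ennreal_double_less_iff I_def F_def)
qed

section \<open>The squared profile\<close>

lemma measurable_ext0_sqrt:
  assumes "continuous_on {0<..} (\<lambda>t. K (sqrt t))"
  shows "(\<lambda>t. ext0 K (sqrt t)) \<in> borel_measurable borel"
proof -
  \<comment> \<open>In HOL \<open>sqrt t\<close> is negative for negative \<open>t\<close>, so the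
    extended profile is constant for \<open>t \<le> 0\<close>.\<close>
  have "(\<lambda>t. if t \<in> {0<..} then ennreal (indicator {0<..} t *\<^sub>R K (sqrt t))
      else Liminf (at_right 0) (\<lambda>s. ennreal (K s))) \<in> borel_measurable borel"
    by (intro measurable_If_set measurable_compose[OF _ measurable_ennreal]
        borel_measurable_continuous_on_indicator assms) auto
  then show ?thesis
    by (rule measurable_cong[THEN iffD1, rotated]) (auto simp: ext0_def)
qed

text \<open>At \<open>0\<close> the strict inequality passes to the lower limit because an intermediate pair of
  points leaves a gap.\<close>

lemma ext0_sqrt_spread:
  assumes K: "\<And>t. 0 < t \<Longrightarrow> 0 < K t"
    and conv: "strictly_convex_pos (\<lambda>t. K (sqrt t))"
    and cont: "continuous_on {0<..} (\<lambda>t. K (sqrt t))"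
    and st: "0 \<le> s'" "s' < s" "s \<le> t" "s + t = s' + t'"
  shows "ext0 K (sqrt s) + ext0 K (sqrt t) < ext0 K (sqrt s') + ext0 K (sqrt t')"
proof -
  define h where "h t = K (sqrt t)" for t
  have h: "0 < h t" if "0 < t" for t
    using K that by (simp add: h_def)
  have ext: "ext0 K (sqrt t) = ennreal (h t)" if "0 < t" for t
    using that by (simp add: ext0_def h_def)
  note spread = strictly_convex_pos_spread[OF conv cont, folded h_def]
  have pos: "0 < s" "0 < t" "0 < t'"
    using st by auto
  show ?thesis
  proof (cases "s' = 0")
    case False
    then have "0 < s'" using st by simp
    then show ?thesis
      using spread[OF _ st(2-4)] h[OF pos(1)] h[OF pos(2)] h[OF pos(3)] h[of s'] pos
      by (simp add: ext ennreal_lessI flip: ennreal_plus)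
  next
    case True
    \<comment> \<open>The pair \<open>s / 2\<close>, \<open>t' - s / 2\<close> lies strictly between
      the inner and the outer pair; \<open>\<eta>\<close> is the gap gained.\<close>
    define D where "D = h (s / 2) + h (t' - s / 2)"
    define \<eta> where "\<eta> = D - (h s + h t)"
    have "0 < \<eta>"
      unfolding \<eta>_def D_def using spread[of "s / 2" s t "t' - s / 2"] st True by simp
    have "isCont h t'"
      using cont pos unfolding h_def by (simp add: continuous_on_eq_continuous_at)
    moreover have "((\<lambda>r. t' - r\<^sup>2) \<longlongrightarrow> t' - 0\<^sup>2) (at_right 0)"
      by (intro tendsto_intros)
    ultimately have "((\<lambda>r. h (t' - r\<^sup>2)) \<longlongrightarrow> h t') (at_right 0)"
      by (intro isCont_tendsto_compose[of t' h]) auto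
    then have "\<forall>\<^sub>F r in at_right 0. h (t' - r\<^sup>2) < h t' + \<eta> / 2"
      using \<open>0 < \<eta>\<close> by (intro order_tendstoD(2)) auto
    moreover have "\<forall>\<^sub>F r in at_right 0. r\<^sup>2 < s / 2"
      using pos(1) by (intro order_tendstoD(2)[of _ "0\<^sup>2"] tendsto_intros) auto
    moreover have "\<forall>\<^sub>F r in at_right 0. 0 < (r :: real)"
      by (simp add: eventually_at_right_less)
    \<comment> \<open>For small \<open>r\<close> the pair \<open>r\<^sup>2\<close>,
      \<open>t' - r\<^sup>2\<close> is spread more widely than the intermediate one. Continuity at
      \<open>t'\<close> costs half of \<open>\<eta>\<close>, and the other half keeps the final
      inequality strict after the lower limit.\<close>
    ultimately have "\<forall>\<^sub>F r in at_right 0. ennreal (D - h t' - \<eta> / 2) \<le> ennreal (K r)"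
    proof eventually_elim
      case (elim r)
      have "D < h (r\<^sup>2) + h (t' - r\<^sup>2)"
        unfolding D_def using spread[of "r\<^sup>2" "s / 2" "t' - s / 2" "t' - r\<^sup>2"] elim st True by simp
      moreover have "h (r\<^sup>2) = K r"
        using elim by (simp add: h_def)
      ultimately show ?case
        using elim by (intro ennreal_leI) simp
    qed
    then have lim: "ennreal (D - h t' - \<eta> / 2) \<le> ext0 K 0"
      by (simp add: ext0_def Liminf_bounded)
    have "ext0 K (sqrt s) + ext0 K (sqrt t) = ennreal (h s + h t)"
      using pos h by (simp add: ext less_imp_le)
    also have "\<dots> < ennreal (D - \<eta> / 2)"
      using \<open>0 < \<eta>\<close> h[OF pos(1)] h[OF pos(2)] by (intro ennreal_lessI) (auto simp: \<eta>_def field_simps)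
    \<comment> \<open>\<open>ennreal\<close> sends negative reals to 0, hence the split on the
      sign.\<close>
    also have "\<dots> \<le> ennreal (D - h t' - \<eta> / 2) + ennreal (h t')"
      using h[OF pos(3)]
      by (cases "0 \<le> D - h t' - \<eta> / 2") (auto simp flip: ennreal_plus simp: ennreal_neg intro!: ennreal_leI)
    also have "\<dots> \<le> ext0 K 0 + ext0 K (sqrt t')"
      using lim pos(3) by (intro add_mono) (auto simp: ext)
    finally show ?thesis
      using True by simp
  qed
qed

lemma ext0_sqrt_spread_abs:
  assumes K: "\<And>t. 0 < t \<Longrightarrow> 0 < K t"
    and conv: "strictly_convex_pos (\<lambda>t. K (sqrt t))"
    and cont: "continuous_on {0<..} (\<lambda>t. K (sqrt t))"
    and st: "0 \<le> s'" "0 \<le> t'" "s + t = s' + t'" "\<bar>s - t\<bar> < \<bar>s' - t'\<bar>"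
  shows "ext0 K (sqrt s) + ext0 K (sqrt t) < ext0 K (sqrt s') + ext0 K (sqrt t')"
proof -
  have *: "ext0 K (sqrt (min s t)) + ext0 K (sqrt (max s t))
      < ext0 K (sqrt (min s' t')) + ext0 K (sqrt (max s' t'))"
    by (rule ext0_sqrt_spread[OF K conv cont]) (use st in linarith)+
  have "ext0 K (sqrt (min u v)) + ext0 K (sqrt (max u v)) = ext0 K (sqrt u) + ext0 K (sqrt v)" for u v
    by (simp add: min_def max_def add.commute)
  then show ?thesis
    using * by simp
qed

section \<open>Sufficiency of strict convexity\<close>

lemma Kbar_swap_less:
  fixes \<mu> :: "('m::finite) matrix2 measure"
  assumes K: "\<And>t. 0 < t \<Longrightarrow> 0 < K t"
    and conv: "strictly_convex_pos (\<lambda>t. K (sqrt t))"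
    and cont: "continuous_on {0<..} (\<lambda>t. K (sqrt t))"
    and h: "haar_O2 \<mu>" and x: "x \<in> cone_side" and y: "y \<in> cone_side"
  shows "Kbar \<mu> K x (prod.swap y) < Kbar \<mu> K x y"
proof -
  define e :: "real ^ 'm" where "e = axis undefined 1"
  have e: "norm e = 1"
    by (simp add: e_def)
  define p q r s where "p = norm (fst x)" "q = norm (snd x)" "r = norm (fst y)" "s = norm (snd y)"
  note defs = p_q_r_s_def
  have pqrs: "0 \<le> q" "q < p" "0 \<le> s" "s < r"
    using x y by (auto simp: defs cone_side_def)
  define N where "N = p\<^sup>2 + q\<^sup>2 + r\<^sup>2 + s\<^sup>2"
  let ?I = "\<lambda>a b. \<integral>\<^sup>+ R. ext0 K (sqrt (N - 2 * (a * cosine e (fst R) + b * cosine e (snd R)))) \<partial>\<mu>"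
  have sp: "space \<mu> = O2"
    by (rule haar_O2D(2)[OF h])
  note meas = measurable_ext0_sqrt[OF cont]
  \<comment> \<open>With \<open>a = p * r\<close>, \<open>b = q * s\<close>,
    \<open>c = p * s\<close> and \<open>d = q * r\<close>, this product is
    \<open>a + b - c - d\<close>.\<close>
  have "0 < (p - q) * (r - s)"
    using pqrs by simp
  then have lt: "p * s < p * r + q * s - q * r"
    by (simp add: algebra_simps)
  have N: "2 * (p * r + q * s) \<le> N"
    using sum_squares_ge_zero[of "p - r" "q - s"] by (simp add: N_def power2_eq_square algebra_simps)
  have cd: "0 \<le> p * s" "0 \<le> q * r"
    using pqrs by auto
  \<comment> \<open>The swapped point lies on the other side of the cone, so the squared distances
    fill at most a compact interval of positive numbers, where the profile is bounded.\<close>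
  have fin: "?I (p * s) (q * r) \<noteq> \<infinity>"
  proof -
    let ?l = "N - 2 * (p * s + q * r)" and ?u = "N + 2 * (p * s + q * r)"
    have "0 < ?l"
      using lt N by simp
    have "compact ((\<lambda>t. K (sqrt t)) ` {?l..?u})"
      using \<open>0 < ?l\<close> by (intro compact_continuous_image continuous_on_subset[OF cont]) auto
    then have "bdd_above ((\<lambda>t. K (sqrt t)) ` {?l..?u})"
      by (intro bounded_imp_bdd_above compact_imp_bounded)
    then obtain M where M: "\<And>t. t \<in> {?l..?u} \<Longrightarrow> K (sqrt t) \<le> M"
      unfolding bdd_above_def by blast
    have "?I (p * s) (q * r) \<le> (\<integral>\<^sup>+ R. ennreal M \<partial>\<mu>)"
    proof (intro nn_integral_mono)
      fix R assume "R \<in> space \<mu>"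
      then have "\<bar>cosine e (fst R)\<bar> \<le> 1" "\<bar>cosine e (snd R)\<bar> \<le> 1"
        using e by (auto simp: sp O2_def cosine_bound)
      then have "\<bar>p * s * cosine e (fst R)\<bar> \<le> p * s" "\<bar>q * r * cosine e (snd R)\<bar> \<le> q * r"
        using cd by (simp_all add: abs_mult[of "p * s"] abs_mult[of "q * r"] mult_left_le)
      then have t: "N - 2 * (p * s * cosine e (fst R) + q * r * cosine e (snd R)) \<in> {?l..?u}"
        by (auto simp: abs_le_iff)
      then have "0 < N - 2 * (p * s * cosine e (fst R) + q * r * cosine e (snd R))"
        using \<open>0 < ?l\<close> by auto
      then show "ext0 K (sqrt (N - 2 * (p * s * cosine e (fst R) + q * r * cosine e (snd R)))) \<le> ennreal M"
        using M[OF t] by (simp add: ext0_def ennreal_leI)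
    qed
    also have "\<dots> < \<infinity>"
      using haar_O2D(5)[OF h] by (simp add: sp ennreal_mult_less_top top.not_eq_extremum)
    finally show ?thesis by simp
  qed
  have "?I (p * s) (q * r) < ?I (p * r) (q * s)"
    by (rule cosine_average_less[OF h e meas ext0_sqrt_spread_abs[OF K conv cont]])
       (use pqrs lt N fin cd in \<open>auto intro: mult_left_mono mult_right_mono\<close>)
  moreover have "Kbar \<mu> K x y = ?I (p * r) (q * s) / emeasure \<mu> O2"
    unfolding Kbar_eq_cosine_integral[OF h e meas] by (simp add: defs N_def)
  moreover have "Kbar \<mu> K x (prod.swap y) = ?I (p * s) (q * r) / emeasure \<mu> O2"
    unfolding Kbar_eq_cosine_integral[OF h e meas] by (simp add: defs N_def add_ac)
  ultimately show ?thesis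
    using haar_O2D(4,5)[OF h]
    by (simp add: divide_ennreal_strict_right_mono del: distrib_left_numeral)
qed

text \<open>With \<open>x = (p e, 0)\<close> and \<open>y = (r e, 0)\<close> all squared distances occurring in the averages lie
  in the interval of concavity, and the average at the swapped point is the value at the mean.\<close>

lemma Kbar_not_less_of_concave:
  fixes \<mu> :: "('m::finite) matrix2 measure"
  assumes K: "\<And>t. 0 < t \<Longrightarrow> 0 < K t"
    and cont: "continuous_on {0<..} (\<lambda>t. K (sqrt t))"
    and h: "haar_O2 \<mu>" and lu: "0 < l" "l < u"
    and conc: "convex_on {l<..<u} (\<lambda>t. - K (sqrt t))"
  obtains x y :: "'m space2" where "x \<in> cone_side" "y \<in> cone_side"
    "Kbar \<mu> K x y \<le> Kbar \<mu> K x (prod.swap y)"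
proof -
  define e :: "real ^ 'm" where "e = axis undefined 1"
  have e: "norm e = 1"
    by (simp add: e_def)
  note meas = measurable_ext0_sqrt[OF cont]
  have sp: "space \<mu> = O2"
    by (rule haar_O2D(2)[OF h])
  \<comment> \<open>\<open>r\<^sup>2\<close> is the midpoint of the interval; for small positive
    \<open>p\<close> both extreme squared distances, of \<open>p - r\<close> and
    \<open>p + r\<close>, stay inside.\<close>
  define r where "r = sqrt ((l + u) / 2)"
  have r: "0 < r" "r\<^sup>2 = (l + u) / 2"
    using lu by (auto simp: r_def)
  have "\<forall>\<^sub>F p in at_right 0. l < p\<^sup>2 + r\<^sup>2 - 2 * (p * r)"
    by (rule order_tendstoD(1)[of _ "0\<^sup>2 + r\<^sup>2 - 2 * (0 * r)"])
       (intro tendsto_intros, use lu r in simp)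
  moreover have "\<forall>\<^sub>F p in at_right 0. p\<^sup>2 + r\<^sup>2 + 2 * (p * r) < u"
    by (rule order_tendstoD(2)[of _ "0\<^sup>2 + r\<^sup>2 + 2 * (0 * r)"])
       (intro tendsto_intros, use lu r in simp)
  moreover have "\<forall>\<^sub>F p in at_right 0. 0 < (p :: real)"
    by (simp add: eventually_at_right_less)
  ultimately have "\<forall>\<^sub>F p in at_right 0. l < p\<^sup>2 + r\<^sup>2 - 2 * (p * r) \<and> p\<^sup>2 + r\<^sup>2 + 2 * (p * r) < u \<and> 0 < p"
    by eventually_elim simp
  then obtain p where p: "l < p\<^sup>2 + r\<^sup>2 - 2 * (p * r)" "p\<^sup>2 + r\<^sup>2 + 2 * (p * r) < u" "0 < p"
    using eventually_happens'[OF trivial_limit_at_right_real] by blast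
  define N where "N = p\<^sup>2 + r\<^sup>2"
  define x y where "x = (p *\<^sub>R e, 0 :: real ^ 'm)" "y = (r *\<^sub>R e, 0 :: real ^ 'm)"
  note xy = x_y_def
  define F where "F v = ext0 K (sqrt (N - 2 * (p * r * v)))" for v
  have Kxy: "Kbar \<mu> K x y = (\<integral>\<^sup>+ R. F (cosine e (fst R)) \<partial>\<mu>) / emeasure \<mu> O2"
    unfolding Kbar_eq_cosine_integral[OF h e meas] using p r e by (simp add: xy N_def F_def)
  have Kxy': "Kbar \<mu> K x (prod.swap y) = (\<integral>\<^sup>+ R. F 0 \<partial>\<mu>) / emeasure \<mu> O2"
    unfolding Kbar_eq_cosine_integral[OF h e meas] using p r e by (simp add: xy N_def F_def)
  have m: "(\<lambda>R. F (cosine e (fst R))) \<in> borel_measurable \<mu>"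
    "(\<lambda>R. F (- cosine e (fst R))) \<in> borel_measurable \<mu>"
    unfolding F_def
    by (intro measurable_compose[OF _ meas] borel_measurable_haar_continuous[OF h] continuous_intros)+
  have F: "F v + F (- v) \<le> F 0 + F 0" if "\<bar>v\<bar> \<le> 1" for v
  proof -
    have "\<bar>p * r * v\<bar> \<le> p * r"
      using that p r by (simp add: abs_mult mult_left_le)
    then have "p * r * v \<le> p * r" "- (p * r) \<le> p * r * v"
      by linarith+
    then have I: "N - 2 * (p * r * v) \<in> {l<..<u}" "N - 2 * (p * r * - v) \<in> {l<..<u}"
      and N: "N \<in> {l<..<u}"
      using p(1,2) mult_pos_pos[OF p(3) r(1)]
      unfolding N_def greaterThanLessThan_iff mult_minus_right by linarith+
    have F_eq: "F w = ennreal (K (sqrt (N - 2 * (p * r * w))))" if "N - 2 * (p * r * w) \<in> {l<..<u}" for w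
      using that lu by (simp add: F_def ext0_def)
    have Kp: "0 \<le> K (sqrt t)" if "t \<in> {l<..<u}" for t
      using K[of "sqrt t"] that lu by simp
    have "K (sqrt (N - 2 * (p * r * v))) + K (sqrt (N - 2 * (p * r * - v))) \<le> K (sqrt N) + K (sqrt N)"
      \<comment> \<open>The smaller outer point must come first, so the sign of \<open>v\<close>
        decides which instance applies.\<close>
      using convex_on_spread[OF conc I(1) I(2), of N N] convex_on_spread[OF conc I(2) I(1), of N N]
      by (cases "0 \<le> p * r * v") auto
    then have "ennreal (K (sqrt (N - 2 * (p * r * v))) + K (sqrt (N - 2 * (p * r * - v))))
        \<le> ennreal (K (sqrt N) + K (sqrt N))"
      by (rule ennreal_leI)
    then show ?thesis
      using F_eq[OF I(1)] F_eq[OF I(2)] F_eq[of 0] N Kp[OF I(1)] Kp[OF I(2)] Kp[OF N]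
      by (simp flip: ennreal_plus)
  qed
  have "(\<integral>\<^sup>+ R. F (cosine e (fst R)) \<partial>\<mu>) + (\<integral>\<^sup>+ R. F (cosine e (fst R)) \<partial>\<mu>)
      = (\<integral>\<^sup>+ R. F (cosine e (fst R)) + F (- cosine e (fst R)) \<partial>\<mu>)"
    using haar_cosine_neg[OF h, of "\<lambda>u v. F u"] m by (simp add: nn_integral_add)
  also have "\<dots> \<le> (\<integral>\<^sup>+ R. F 0 + F 0 \<partial>\<mu>)"
    using e by (intro nn_integral_mono F) (auto simp: sp O2_def cosine_bound)
  also have "\<dots> = (\<integral>\<^sup>+ R. F 0 \<partial>\<mu>) + (\<integral>\<^sup>+ R. F 0 \<partial>\<mu>)"
    by (rule nn_integral_add) auto
  finally have "Kbar \<mu> K x y \<le> Kbar \<mu> K x (prod.swap y)"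
    unfolding Kxy Kxy' ennreal_double_le_iff by (rule divide_right_mono_ennreal)
  moreover have "x \<in> cone_side" "y \<in> cone_side"
    using p r e by (auto simp: xy cone_side_def)
  ultimately show ?thesis
    using that by blast
qed

text \<open>The strict inequality makes the subtracted average finite, so the extended difference is
  never of the form infinity minus infinity.\<close>

lemma odd_kernel_pos:
  assumes "Kbar \<mu> K x (prod.swap y) < Kbar \<mu> K x y"
  shows "0 < odd_kernel \<mu> K x y"
proof -
  have "Kbar \<mu> K x (prod.swap y) \<noteq> top"
    using assms by auto
  then show ?thesis
    using assms unfolding odd_kernel_def by (simp add: ereal_less_minus_iff less_ennreal.rep_eq)
qed

theorem theorem1p1:
  fixes K :: "real \<Rightarrow> real" and \<mu> :: "('m::finite) matrix2 measure"
  assumes K_pos: "\<And>t. t > 0 \<Longrightarrow> K t > 0"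
    and K_measurable: "K \<in> borel_measurable (lebesgue_on {0<..})"
    and haar: "haar_O2 \<mu>"
  shows "(strictly_convex_pos (\<lambda>\<tau>. K (sqrt \<tau>)) \<longrightarrow>
            (\<forall>x\<in>cone_side. \<forall>y\<in>cone_side. odd_kernel \<mu> K x y > 0) \<and>
            (\<forall>x\<in>cone_side. \<forall>y\<in>cone_side. Kbar \<mu> K x y > Kbar \<mu> K x (prod.swap y))) \<and>
         (C2_pos K \<longrightarrow>
            (strictly_convex_pos (\<lambda>\<tau>. K (sqrt \<tau>)) \<longleftrightarrow>
             (\<forall>x\<in>cone_side. \<forall>y\<in>cone_side. Kbar \<mu> K x y > Kbar \<mu> K x (prod.swap y))))"
proof -
  have suff: "Kbar \<mu> K x (prod.swap y) < Kbar \<mu> K x y"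
    if "strictly_convex_pos (\<lambda>\<tau>. K (sqrt \<tau>))" "x \<in> cone_side" "y \<in> cone_side" for x y
    using that by (intro Kbar_swap_less K_pos haar strictly_convex_pos_continuous K_measurable)
  have nec: "strictly_convex_pos (\<lambda>\<tau>. K (sqrt \<tau>))"
    if "C2_pos K" and ineq: "\<forall>x\<in>cone_side. \<forall>y\<in>cone_side. Kbar \<mu> K x y > Kbar \<mu> K x (prod.swap y)"
  proof (rule ccontr)
    assume ncvx: "\<not> strictly_convex_pos (\<lambda>\<tau>. K (sqrt \<tau>))"
    obtain h' h'' where
      h: "\<And>t. 0 < t \<Longrightarrow> ((\<lambda>\<tau>. K (sqrt \<tau>)) has_real_derivative h' t) (at t)"
      and h': "\<And>t. 0 < t \<Longrightarrow> (h' has_real_derivative h'' t) (at t)" "continuous_on {0<..} h''"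
      using C2_pos_comp_sqrt[OF \<open>C2_pos K\<close>] by (auto simp: C2_pos_def)
    obtain l u where lu: "0 < l" "l < u" "convex_on {l<..<u} (\<lambda>\<tau>. - K (sqrt \<tau>))"
      using not_strictly_convex_pos_imp_concave[OF h h' ncvx] .
    have "continuous_on {0<..} (\<lambda>\<tau>. K (sqrt \<tau>))"
      using h by (auto intro!: continuous_at_imp_continuous_on DERIV_isCont)
    from Kbar_not_less_of_concave[OF K_pos this haar lu] show False
      using ineq by (metis not_le)
  qed
  show ?thesis
    using suff nec odd_kernel_pos by blast
qed

end
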